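(* Let $k$ be an algebraically closed field of characteristic zero and let $C$ be an irreducible smooth affine curve over $k$ with a unique place at infinity. Assume that $C$ is not rational and that the tangent sheaf $\mathcal{T}_C$ of $C$ is trivial. Then the bracket width of the simple Lie algebra $\mathrm{Vec}(C)$ is larger than or equal to two. More precisely, no nowhere vanishing vector field on $C$ can be equal to the Lie bracket of two vector fields on $C$.
   Context: $\mathrm{Vec}(C)=H^0(C,\mathcal{T}_C)$ is the Lie algebra of global algebraic vector fields on $C$ (identified with $k$-derivations of $\mathcal{O}(C)$). A smooth affine curve $C$ has a unique place at infinity if it is the complement of a single closed point in a smooth projective curve $\bar C$. For a Lie algebra $L$, the bracket width is the supremum over $a\in[L,L]$ of the smallest number $m$ such that $a=\sum_{i=1}^m[x_i,y_i]$ with $x_i,y_i\in L$. *)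

theory Defs
  imports "HOL-Computational_Algebra.Polynomial" "HOL-Computational_Algebra.Fraction_Field"
begin

text \<open>Algebraic model. The affine curve C is encoded by its coordinate ring O(C), taken to be
 a type 'a of class idom (a domain = irreducible), together with the structure map
 iota : k -> O(C) making it a k-algebra. Points of C are the maximal ideals of O(C).\<close>

definition alg_closed :: "'k::field itself \<Rightarrow> bool" where
  "alg_closed _ \<longleftrightarrow> (\<forall>p::'k poly. degree p \<ge> 1 \<longrightarrow> (\<exists>x. poly p x = 0))"

definition k_algebra_map :: "('k::field \<Rightarrow> 'a::comm_ring_1) \<Rightarrow> bool" where
  "k_algebra_map \<iota> \<longleftrightarrow> \<iota> 1 = 1 \<and> (\<forall>a b. \<iota> (a + b) = \<iota> a + \<iota> b) \<and> (\<forall>a b. \<iota> (a * b) = \<iota> a * \<iota> b)"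

inductive_set subalg_gen :: "('k::field \<Rightarrow> 'a::comm_ring_1) \<Rightarrow> 'a set \<Rightarrow> 'a set"
  for \<iota> S where
  scal: "\<iota> c \<in> subalg_gen \<iota> S"
| gen: "s \<in> S \<Longrightarrow> s \<in> subalg_gen \<iota> S"
| add: "x \<in> subalg_gen \<iota> S \<Longrightarrow> y \<in> subalg_gen \<iota> S \<Longrightarrow> x + y \<in> subalg_gen \<iota> S"
| mult: "x \<in> subalg_gen \<iota> S \<Longrightarrow> y \<in> subalg_gen \<iota> S \<Longrightarrow> x * y \<in> subalg_gen \<iota> S"

definition fin_gen_algebra :: "('k::field \<Rightarrow> 'a::comm_ring_1) \<Rightarrow> bool" where
  "fin_gen_algebra \<iota> \<longleftrightarrow> (\<exists>S. finite S \<and> subalg_gen \<iota> S = UNIV)"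

definition is_ideal :: "'a::comm_ring_1 set \<Rightarrow> bool" where
  "is_ideal I \<longleftrightarrow> 0 \<in> I \<and> (\<forall>x\<in>I. \<forall>y\<in>I. x + y \<in> I) \<and> (\<forall>x\<in>I. \<forall>r. r * x \<in> I)"

definition prime_ideal :: "'a::comm_ring_1 set \<Rightarrow> bool" where
  "prime_ideal P \<longleftrightarrow> is_ideal P \<and> 1 \<notin> P \<and> (\<forall>x y. x * y \<in> P \<longrightarrow> x \<in> P \<or> y \<in> P)"

definition maximal_ideal :: "'a::comm_ring_1 set \<Rightarrow> bool" where
  "maximal_ideal M \<longleftrightarrow> is_ideal M \<and> 1 \<notin> M \<and> (\<forall>J. is_ideal J \<and> M \<subseteq> J \<longrightarrow> J = M \<or> 1 \<in> J)"

inductive_set ideal_sq :: "'a::comm_ring_1 set \<Rightarrow> 'a set" for M where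
  zero: "0 \<in> ideal_sq M"
| prod: "x \<in> M \<Longrightarrow> y \<in> M \<Longrightarrow> x * y \<in> ideal_sq M"
| add: "a \<in> ideal_sq M \<Longrightarrow> b \<in> ideal_sq M \<Longrightarrow> a + b \<in> ideal_sq M"

definition krull_dim_one :: "'a::idom itself \<Rightarrow> bool" where
  "krull_dim_one _ \<longleftrightarrow> (\<exists>x::'a. x \<noteq> 0 \<and> \<not> x dvd 1) \<and>
     (\<forall>P::'a set. prime_ideal P \<and> P \<noteq> {0} \<longrightarrow> maximal_ideal P)"

text \<open>Smoothness (regularity at every closed point, k algebraically closed):
 for every maximal ideal m, the cotangent space m/m^2 has dimension at most one,
 i.e. m is generated modulo m^2 by a single element (dimension exactly one is then forced
 by Krull dimension one).\<close>
definition smooth_curve_ring :: "'a::idom itself \<Rightarrow> bool" where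
  "smooth_curve_ring _ \<longleftrightarrow> (\<forall>M::'a set. maximal_ideal M \<longrightarrow>
      (\<exists>t\<in>M. \<forall>x\<in>M. \<exists>r. x - r * t \<in> ideal_sq M))"

definition emb :: "'a::idom \<Rightarrow> 'a fract" where
  "emb x = Fract x 1"

text \<open>Places of the function field k(C) = Frac O(C) over k: proper valuation rings of k(C)
 containing k. (For a function field of one variable these are exactly the DVRs,
 i.e. the points of the smooth projective model.) A place at infinity is one not containing O(C).\<close>
definition place :: "('k::field \<Rightarrow> 'a::idom) \<Rightarrow> 'a fract set \<Rightarrow> bool" where
  "place \<iota> V \<longleftrightarrow> 0 \<in> V \<and> 1 \<in> V \<and> (\<forall>x\<in>V. \<forall>y\<in>V. x + y \<in> V \<and> x * y \<in> V \<and> - x \<in> V)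
     \<and> (\<forall>x. x \<noteq> 0 \<longrightarrow> x \<in> V \<or> inverse x \<in> V) \<and> V \<noteq> UNIV \<and> (\<forall>c. emb (\<iota> c) \<in> V)"

definition place_at_infinity :: "('k::field \<Rightarrow> 'a::idom) \<Rightarrow> 'a fract set \<Rightarrow> bool" where
  "place_at_infinity \<iota> V \<longleftrightarrow> place \<iota> V \<and> \<not> range emb \<subseteq> V"

definition unique_place_at_infinity :: "('k::field \<Rightarrow> 'a::idom) \<Rightarrow> bool" where
  "unique_place_at_infinity \<iota> \<longleftrightarrow> (\<exists>!V. place_at_infinity \<iota> V)"

inductive_set subfield_gen :: "('k::field \<Rightarrow> 'a::idom) \<Rightarrow> 'a fract set \<Rightarrow> 'a fract set"
  for \<iota> S where
  scal: "emb (\<iota> c) \<in> subfield_gen \<iota> S"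
| gen: "s \<in> S \<Longrightarrow> s \<in> subfield_gen \<iota> S"
| add: "x \<in> subfield_gen \<iota> S \<Longrightarrow> y \<in> subfield_gen \<iota> S \<Longrightarrow> x + y \<in> subfield_gen \<iota> S"
| neg: "x \<in> subfield_gen \<iota> S \<Longrightarrow> - x \<in> subfield_gen \<iota> S"
| mult: "x \<in> subfield_gen \<iota> S \<Longrightarrow> y \<in> subfield_gen \<iota> S \<Longrightarrow> x * y \<in> subfield_gen \<iota> S"
| inv: "x \<in> subfield_gen \<iota> S \<Longrightarrow> inverse x \<in> subfield_gen \<iota> S"

definition rational_curve :: "('k::field \<Rightarrow> 'a::idom) \<Rightarrow> bool" where
  "rational_curve \<iota> \<longleftrightarrow> (\<exists>t. subfield_gen \<iota> {t} = UNIV)"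

definition k_derivation :: "('k::field \<Rightarrow> 'a::comm_ring_1) \<Rightarrow> ('a \<Rightarrow> 'a) \<Rightarrow> bool" where
  "k_derivation \<iota> D \<longleftrightarrow> (\<forall>x y. D (x + y) = D x + D y) \<and> (\<forall>x y. D (x * y) = x * D y + y * D x)
     \<and> (\<forall>c x. D (\<iota> c * x) = \<iota> c * D x)"

definition Vec :: "('k::field \<Rightarrow> 'a::comm_ring_1) \<Rightarrow> ('a \<Rightarrow> 'a) set" where
  "Vec \<iota> = {D. k_derivation \<iota> D}"

definition lie_bracket :: "('a::comm_ring_1 \<Rightarrow> 'a) \<Rightarrow> ('a \<Rightarrow> 'a) \<Rightarrow> 'a \<Rightarrow> 'a" where
  "lie_bracket D1 D2 = (\<lambda>x. D1 (D2 x) - D2 (D1 x))"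

text \<open>Trivial tangent sheaf: Vec(C) = H^0(C, T_C) is a free O(C)-module of rank one.\<close>
definition tangent_sheaf_trivial :: "('k::field \<Rightarrow> 'a::comm_ring_1) \<Rightarrow> bool" where
  "tangent_sheaf_trivial \<iota> \<longleftrightarrow> (\<exists>D0 \<in> Vec \<iota>. \<forall>D \<in> Vec \<iota>. \<exists>!f. D = (\<lambda>x. f * D0 x))"

definition nowhere_vanishing :: "('a::comm_ring_1 \<Rightarrow> 'a) \<Rightarrow> bool" where
  "nowhere_vanishing D \<longleftrightarrow> (\<forall>M. maximal_ideal M \<longrightarrow> \<not> range D \<subseteq> M)"

inductive_set derived :: "('a \<Rightarrow> 'a::comm_ring_1) set \<Rightarrow> ('a \<Rightarrow> 'a) set" for L where
  br: "x \<in> L \<Longrightarrow> y \<in> L \<Longrightarrow> lie_bracket x y \<in> derived L"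
| add: "a \<in> derived L \<Longrightarrow> b \<in> derived L \<Longrightarrow> (\<lambda>x. a x + b x) \<in> derived L"

definition bracket_width_ge_two :: "('a \<Rightarrow> 'a::comm_ring_1) set \<Rightarrow> bool" where
  "bracket_width_ge_two L \<longleftrightarrow> (\<exists>a \<in> derived L. \<not> (\<exists>x\<in>L. \<exists>y\<in>L. a = lie_bracket x y))"

end

theory Submission
  imports Defs
begin

text \<open>Let V be the valuation ring of the place at infinity. Chevalley's extension theorem and the
  uniqueness of V give O(C) \<inter> V = k and the residue field k, make V archimedean, and make O(C)/xO(C)
  finite-dimensional for every non-constant x, so the pole orders at infinity are well-ordered and
  pairwise commensurable. A generator D of the vector fields then shifts the pole orders of all
  non-constant functions by one and the same amount. A nowhere vanishing field is a constant multiple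
  of D since units are constant, so if it is a bracket then f D g - g D f is a non-zero constant for
  some f and g, which forces that shift to be negative. Hence D lowers pole orders, a function t of
  minimal positive pole order has constant derivative, and integrating gives O(C) = k[t]: the curve
  is rational.

  The first claim follows because D itself lies in the derived algebra: the coefficients of
  the derived algebra form the ideal generated by the image of D, and by smoothness D has no zeros.\<close>

section \<open>Valuation rings\<close>

text \<open>The place is given only as a valuation ring V, without a value group or a local
  parameter. Pole orders are therefore compared by divisibility in V, and residues in k stand in for
  leading coefficients. The engine is one criterion: an element lying in every valuation ring over B
  is integral over B. By uniqueness a valuation ring over k is V or contains O(C), so enlarging k to
  k + N steers which rings occur: N the maximal ideal of V yields the residue field, while N = xO(C)
  with x non-constant excludes V and yields algebraicity modulo x.

  The sign of the shift comes from leading terms. If f^q and c g^p agree to leading order,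
  differentiating gives q (D f)/f ~ p (D g)/g. For p distinct from q the Wronskian f D g - g D f
  then has the order of f g raised by the shift, and it could not be constant if the shift were
  non-negative. Equal orders are avoided by subtracting from g a constant multiple of f, which
  leaves the Wronskian unchanged.\<close>

definition subring :: "'a::comm_ring_1 set \<Rightarrow> bool" where
  "subring R \<longleftrightarrow> 0 \<in> R \<and> 1 \<in> R \<and> (\<forall>x\<in>R. \<forall>y\<in>R. x + y \<in> R \<and> x * y \<in> R \<and> - x \<in> R)"

definition ideal_of :: "'a::comm_ring_1 set \<Rightarrow> 'a set \<Rightarrow> bool" where
  "ideal_of R J \<longleftrightarrow> J \<subseteq> R \<and> 0 \<in> J \<and> (\<forall>x\<in>J. \<forall>y\<in>J. x + y \<in> J) \<and> (\<forall>r\<in>R. \<forall>x\<in>J. r * x \<in> J)"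

text \<open>The whole field is allowed here, unlike in \<open>place\<close>; properness follows
  wherever A is not contained in W.\<close>

definition valuation_ring :: "'a::field set \<Rightarrow> bool" where
  "valuation_ring W \<longleftrightarrow> subring W \<and> (\<forall>x. x \<in> W \<or> inverse x \<in> W)"

definition polys_over :: "'a::comm_ring_1 set \<Rightarrow> 'a poly set" where
  "polys_over B = {p. \<forall>i. coeff p i \<in> B}"

text \<open>For a subring this is B[x]. It is also applied to an ideal J of W, where it is the
  extension of J to W[x].\<close>

definition adjoin :: "'a::comm_ring_1 set \<Rightarrow> 'a \<Rightarrow> 'a set" where
  "adjoin B x = (\<lambda>p. poly p x) ` polys_over B"

lemma subringD:
  assumes "subring R"
  shows "0 \<in> R" "1 \<in> R" "\<And>x y. x \<in> R \<Longrightarrow> y \<in> R \<Longrightarrow> x + y \<in> R"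
    "\<And>x y. x \<in> R \<Longrightarrow> y \<in> R \<Longrightarrow> x * y \<in> R" "\<And>x. x \<in> R \<Longrightarrow> - x \<in> R"
    "\<And>x y. x \<in> R \<Longrightarrow> y \<in> R \<Longrightarrow> x - y \<in> R" "\<And>x n. x \<in> R \<Longrightarrow> x ^ n \<in> R"
    "\<And>n. of_nat n \<in> R"
proof -
  show *: "0 \<in> R" "1 \<in> R" "\<And>x y. x \<in> R \<Longrightarrow> y \<in> R \<Longrightarrow> x + y \<in> R"
    "\<And>x y. x \<in> R \<Longrightarrow> y \<in> R \<Longrightarrow> x * y \<in> R" "\<And>x. x \<in> R \<Longrightarrow> - x \<in> R"
    using assms unfolding subring_def by auto
  show "\<And>x y. x \<in> R \<Longrightarrow> y \<in> R \<Longrightarrow> x - y \<in> R"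
    by (metis *(3,5) diff_conv_add_uminus)
  show "x ^ n \<in> R" if "x \<in> R" for x n using that by (induction n) (auto intro: *)
  show "of_nat n \<in> R" for n by (induction n) (auto intro: *)
qed

lemma sum_closed:
  assumes "0 \<in> B" "\<And>x y. x \<in> B \<Longrightarrow> y \<in> B \<Longrightarrow> x + y \<in> B" "\<And>i. i \<in> I \<Longrightarrow> f i \<in> B"
  shows "sum f I \<in> (B :: 'a::comm_monoid_add set)"
  using assms(3) by (induction I rule: infinite_finite_induct) (auto intro: assms(1,2))

lemma subring_adjoin:
  assumes "subring R" shows "subring (adjoin R x)"
proof -
  note R = subringD[OF assms]
  have "(0::'a poly) \<in> polys_over R" "1 \<in> polys_over R"
    using R(1,2) by (auto simp: polys_over_def)
  moreover have "p + q \<in> polys_over R" "p * q \<in> polys_over R" "- p \<in> polys_over R"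
    if "p \<in> polys_over R" "q \<in> polys_over R" for p q
    using that by (auto simp: polys_over_def coeff_mult intro!: R sum_closed)
  ultimately show ?thesis
    unfolding subring_def adjoin_def
    by (auto simp flip: poly_add poly_mult poly_minus intro: rev_image_eqI)
qed

lemma adjoin_superset: "0 \<in> R \<Longrightarrow> R \<subseteq> adjoin R x"
proof
  fix r assume "0 \<in> R" "r \<in> R"
  then have "[:r:] \<in> polys_over R" by (auto simp: polys_over_def coeff_pCons split: nat.split)
  then show "r \<in> adjoin R x" unfolding adjoin_def by (auto intro!: rev_image_eqI)
qed

lemma adjoin_generator: "0 \<in> R \<Longrightarrow> 1 \<in> R \<Longrightarrow> x \<in> adjoin R x"
  unfolding adjoin_def
  by (rule rev_image_eqI[of "[:0, 1:]"]) (auto simp: polys_over_def coeff_pCons split: nat.split)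

lemma ideal_of_adjoin:
  assumes "subring R" "ideal_of R J" shows "ideal_of (adjoin R x) (adjoin J x)"
proof -
  have J: "J \<subseteq> R" "0 \<in> J" "\<And>x y. x \<in> J \<Longrightarrow> y \<in> J \<Longrightarrow> x + y \<in> J"
    "\<And>x y. x \<in> R \<Longrightarrow> y \<in> J \<Longrightarrow> x * y \<in> J"
    using assms(2) by (auto simp: ideal_of_def)
  have "polys_over J \<subseteq> polys_over R" using J(1) by (auto simp: polys_over_def)
  moreover have "(0::'a poly) \<in> polys_over J" using J(2) by (auto simp: polys_over_def)
  moreover have "p + q \<in> polys_over J" if "p \<in> polys_over J" "q \<in> polys_over J" for p q
    using that by (auto simp: polys_over_def intro: J)
  moreover have "p * q \<in> polys_over J" if "p \<in> polys_over R" "q \<in> polys_over J" for p q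
    using that by (auto simp: polys_over_def coeff_mult intro!: J sum_closed[where B=J])
  ultimately show ?thesis
    unfolding ideal_of_def adjoin_def
    by (auto simp flip: poly_add poly_mult intro: rev_image_eqI)
qed

text \<open>One step of the exchange argument in Chevalley's extension theorem: the relation for
  the inverse of x rewrites the leading term of the relation for x.\<close>
lemma chevalley_degree_step:
  fixes x :: "'f::field"
  assumes "subring W" "ideal_of W J" "1 \<notin> J"
    and unit: "\<And>j. j \<in> J \<Longrightarrow> inverse (1 - j) \<in> W"
    and "x \<noteq> 0" "p \<in> polys_over J" "poly p x = 1"
    and "q \<in> polys_over J" "poly q (inverse x) = 1" "degree q \<le> degree p"
  shows "\<exists>p'\<in>polys_over J. poly p' x = 1 \<and> degree p' < degree p"
proof -
  note W = subringD[OF assms(1)]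
  have J: "J \<subseteq> W" "0 \<in> J" "\<And>x y. x \<in> J \<Longrightarrow> y \<in> J \<Longrightarrow> x + y \<in> J"
    "\<And>x y. x \<in> W \<Longrightarrow> y \<in> J \<Longrightarrow> x * y \<in> J"
    using assms(2) by (auto simp: ideal_of_def)
  have Jm: "- x \<in> J" if "x \<in> J" for x using J(4)[of "-1" x] W that by auto
  define n m where "n = degree p" and "m = degree q"
  have q: "coeff q i \<in> J" and p: "coeff p i \<in> J" for i
    using assms by (auto simp: polys_over_def)
  have "m > 0"
  proof (rule ccontr)
    assume "\<not> m > 0"
    then obtain c where "q = [:c:]" unfolding m_def by (auto elim: degree_eq_zeroE)
    with assms(9) q[of 0] assms(3) show False by simp
  qed
  define u where "u = inverse (1 - coeff q 0)"
  have "u \<in> W" using unit q unfolding u_def by auto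
  have ne: "1 - coeff q 0 \<noteq> 0" using q[of 0] assms(3) by auto
  \<comment> \<open>Multiplying q(1/x) = 1 by x^m gives (1 - q_0) x^m = q_1 x^(m-1) + ... + q_m.
    Dividing by the unit 1 - q_0 expresses x^m as r(x), with r of degree below m and coefficients in
    J.\<close>
  define r where "r = smult u (reflect_poly q - monom (coeff q 0) m)"
  have cr: "coeff r i \<in> J" for i
    unfolding r_def coeff_smult
    by (rule J(4)[OF \<open>u \<in> W\<close>])
       (auto simp: coeff_reflect_poly m_def intro!: J(2) q Jm split: if_splits)
  have dr: "degree r < m"
  proof -
    have "coeff r i = 0" if "i \<ge> m" for i
      using that by (auto simp: r_def coeff_reflect_poly m_def split: if_splits)
    then show ?thesis using \<open>m > 0\<close> by (metis degree_0 leading_coeff_0_iff not_le)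
  qed
  have "poly (reflect_poly q) x = x ^ m"
    using poly_reflect_poly_nz[OF \<open>x \<noteq> 0\<close>, of q] assms(9) by (simp add: m_def)
  then have xr: "poly r x = x ^ m"
    using ne by (simp add: r_def poly_monom u_def field_simps)
  \<comment> \<open>The leading term c x^n of p is replaced by c x^(n-m) r(x), which has the same
    value at x but lower degree.\<close>
  define p' where "p' = p - monom (coeff p n) n + monom (coeff p n) (n - m) * r"
  have nm: "m \<le> n" using assms(10) by (simp add: n_def m_def)
  have "poly p' x = 1"
    using assms(7) nm by (simp add: p'_def poly_monom xr flip: power_add)
  moreover have "p' \<in> polys_over J"
    unfolding polys_over_def p'_def
    using J(1) by (auto simp: coeff_monom_mult intro!: p cr J(2,3,4) split: if_splits)
  moreover have "degree p' < n"
  proof -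
    have "coeff p' i = 0" if "i \<ge> n" for i
    proof -
      have "coeff (p - monom (coeff p n) n) i = 0"
        using that by (auto simp: n_def coeff_eq_0)
      moreover have "coeff r (i - (n - m)) = 0"
        using that dr nm by (intro coeff_eq_0) auto
      ultimately show ?thesis by (simp add: p'_def coeff_monom_mult)
    qed
    then show ?thesis using \<open>m > 0\<close> nm by (metis degree_0 leading_coeff_0_iff not_le less_le_trans)
  qed
  ultimately show ?thesis by (auto simp: n_def)
qed

text \<open>Infinite descent on the sum of the two degrees: the relation of larger degree is always
  shortened by the other one, since x and its inverse play symmetric roles.\<close>

lemma chevalley_no_relations:
  fixes x :: "'f::field"
  assumes "subring W" "ideal_of W J" "1 \<notin> J"
    and "\<And>j. j \<in> J \<Longrightarrow> inverse (1 - j) \<in> W"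
    and "x \<noteq> 0" "p \<in> polys_over J" "poly p x = 1"
    and "q \<in> polys_over J" "poly q (inverse x) = 1"
  shows False
  using assms(5-)
proof (induction "degree p + degree q" arbitrary: p q rule: less_induct)
  case less
  show ?case
  proof (cases "degree q \<le> degree p")
    case True
    then obtain p' where "p' \<in> polys_over J" "poly p' x = 1" "degree p' < degree p"
      using chevalley_degree_step[OF assms(1-4)] less.prems by metis
    then show ?thesis using less.hyps[of p' q] less.prems by auto
  next
    case False
    then obtain q' where "q' \<in> polys_over J" "poly q' (inverse x) = 1" "degree q' < degree q"
      using chevalley_degree_step[OF assms(1-4), of "inverse x" q p] less.prems by auto
    then show ?thesis using less.hyps[of p q'] less.prems by auto
  qed
qed

text \<open>Among pairs of a ring and a proper ideal extending (R, I), a maximal pair (W, J) has a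
  valuation ring as its first component. A non-zero y in I stays in the proper ideal J, so its
  inverse cannot lie in W.\<close>

theorem chevalley_extension:
  fixes R I :: "'f::field set"
  assumes "subring R" "ideal_of R I" "1 \<notin> I"
  shows "\<exists>W. valuation_ring W \<and> R \<subseteq> W \<and> (\<forall>y\<in>I. y \<noteq> 0 \<longrightarrow> inverse y \<notin> W)"
proof -
  \<comment> \<open>A pair (W, J) is coded as the single set \<open>W <+> J\<close>, so that
    componentwise inclusion becomes plain inclusion and the subset form of Zorn's lemma
    applies.\<close>
  define good :: "('f + 'f) set \<Rightarrow> bool" where
    "good X \<longleftrightarrow> R \<subseteq> Inl -` X \<and> I \<subseteq> Inr -` X \<and> subring (Inl -` X) \<and>
       ideal_of (Inl -` X) (Inr -` X) \<and> Inr 1 \<notin> X" for X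
  have good_Plus: "good (W <+> J) \<longleftrightarrow> R \<subseteq> W \<and> I \<subseteq> J \<and> subring W \<and> ideal_of W J \<and> 1 \<notin> J" for W J
  proof -
    have "Inl -` (W <+> J) = W" "Inr -` (W <+> J) = J" by auto
    then show ?thesis by (auto simp: good_def)
  qed
  have "\<exists>M\<in>Collect good. \<forall>X\<in>Collect good. M \<subseteq> X \<longrightarrow> X = M"
  proof (rule subset_Zorn_nonempty)
    show "Collect good \<noteq> {}" using good_Plus[of R I] assms by blast
    fix C assume C: "C \<noteq> {}" "subset.chain (Collect good) C"
    then have g: "\<And>X. X \<in> C \<Longrightarrow> good X" by (auto simp: subset.chain_def)
    have two: "\<exists>Z\<in>C. X \<subseteq> Z \<and> Y \<subseteq> Z" if "X \<in> C" "Y \<in> C" for X Y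
    proof -
      have "X \<subseteq> Y \<or> Y \<subseteq> X" using C(2) that by (auto simp: subset_chain_def)
      then show ?thesis using that by (elim disjE) (auto intro: bexI[of _ X] bexI[of _ Y])
    qed
    have sub: "Inl (x + y) \<in> X" "Inl (x * y) \<in> X" "Inl (- x) \<in> X"
      if "X \<in> C" "Inl x \<in> X" "Inl y \<in> X" for X x y
      using g[OF that(1)] that(2,3) by (simp_all add: good_def subring_def)
    have ide: "Inr x \<in> X \<Longrightarrow> Inl x \<in> X" "Inr x \<in> X \<Longrightarrow> Inr y \<in> X \<Longrightarrow> Inr (x + y) \<in> X"
      "Inl x \<in> X \<Longrightarrow> Inr y \<in> X \<Longrightarrow> Inr (x * y) \<in> X" if "X \<in> C" for X x y
      using g[OF that(1)] by (auto simp: good_def ideal_of_def)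
    have "subring (Inl -` \<Union>C)"
      unfolding subring_def
    proof (intro conjI ballI)
      obtain X where "X \<in> C" using C(1) by blast
      with g[of X] show "0 \<in> Inl -` \<Union>C" "1 \<in> Inl -` \<Union>C"
        by (auto simp: good_def subring_def)
      fix x y assume "x \<in> Inl -` \<Union>C" "y \<in> Inl -` \<Union>C"
      then obtain X Y where "X \<in> C" "Inl x \<in> X" "Y \<in> C" "Inl y \<in> Y" by auto
      with two obtain Z where "Z \<in> C" "Inl x \<in> Z" "Inl y \<in> Z" by blast
      then have "Inl (x + y) \<in> Z" "Inl (x * y) \<in> Z" "Inl (- x) \<in> Z"
        using sub[of Z] by auto
      with \<open>Z \<in> C\<close> show "x + y \<in> Inl -` \<Union>C" "x * y \<in> Inl -` \<Union>C" "- x \<in> Inl -` \<Union>C"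
        by auto
    qed
    moreover have "ideal_of (Inl -` \<Union>C) (Inr -` \<Union>C)"
      unfolding ideal_of_def
    proof (intro conjI ballI subsetI)
      obtain X where "X \<in> C" using C(1) by blast
      with g[of X] show "0 \<in> Inr -` \<Union>C" by (auto simp: good_def ideal_of_def)
      show "x \<in> Inl -` \<Union>C" if "x \<in> Inr -` \<Union>C" for x
        using ide(1) that by auto
      show "x + y \<in> Inr -` \<Union>C" if xy: "x \<in> Inr -` \<Union>C" "y \<in> Inr -` \<Union>C" for x y
      proof -
        obtain X Y where "X \<in> C" "Inr x \<in> X" "Y \<in> C" "Inr y \<in> Y" using xy by auto
        with two obtain Z where "Z \<in> C" "Inr x \<in> Z" "Inr y \<in> Z" by blast
        with ide(2) show ?thesis by auto
      qed
      show "x * y \<in> Inr -` \<Union>C" if xy: "x \<in> Inl -` \<Union>C" "y \<in> Inr -` \<Union>C" for x y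
      proof -
        obtain X Y where "X \<in> C" "Inl x \<in> X" "Y \<in> C" "Inr y \<in> Y" using xy by auto
        with two obtain Z where "Z \<in> C" "Inl x \<in> Z" "Inr y \<in> Z" by blast
        with ide(3) show ?thesis by auto
      qed
    qed
    moreover have "R \<subseteq> Inl -` \<Union>C" "I \<subseteq> Inr -` \<Union>C" "Inr 1 \<notin> \<Union>C"
      using C(1) g by (fastforce simp: good_def)+
    ultimately show "\<Union>C \<in> Collect good" by (simp add: good_def)
  qed
  then obtain M where M: "good M" and max: "\<And>X. good X \<Longrightarrow> M \<subseteq> X \<Longrightarrow> X = M" by auto
  define W J where "W = Inl -` M" and "J = Inr -` M"
  have WJ: "R \<subseteq> W" "I \<subseteq> J" "subring W" "ideal_of W J" "1 \<notin> J"
    using M by (auto simp: good_def W_def J_def)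
  note W = subringD[OF WJ(3)]
  have J: "J \<subseteq> W" "0 \<in> J" "\<And>x y. x \<in> J \<Longrightarrow> y \<in> J \<Longrightarrow> x + y \<in> J"
    "\<And>x y. x \<in> W \<Longrightarrow> y \<in> J \<Longrightarrow> x * y \<in> J"
    using WJ(4) by (auto simp: ideal_of_def)
  \<comment> \<open>By maximality, adjoining an x outside W must destroy properness of the ideal: 1
    becomes a polynomial in x with coefficients in J.\<close>
  have relation: "\<exists>p\<in>polys_over J. poly p x = 1" if "x \<notin> W" for x
  proof (rule ccontr)
    assume "\<not> ?thesis"
    then have no: "1 \<notin> adjoin J x" by (auto simp: adjoin_def)
    have sup: "W \<subseteq> adjoin W x" "J \<subseteq> adjoin J x" using adjoin_superset W(1) J(2) by blast+
    have "good (adjoin W x <+> adjoin J x)"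
      unfolding good_Plus
      using no WJ sup subring_adjoin[OF WJ(3)] ideal_of_adjoin[OF WJ(3,4)] by blast
    moreover have "M \<subseteq> adjoin W x <+> adjoin J x"
    proof
      fix z assume "z \<in> M"
      then show "z \<in> adjoin W x <+> adjoin J x"
        using sup by (cases z) (auto simp: W_def J_def)
    qed
    ultimately have "adjoin W x <+> adjoin J x = M" using max by blast
    then have "adjoin W x = W" unfolding W_def by auto
    then show False using adjoin_generator[OF W(1,2), of x] that by simp
  qed
  \<comment> \<open>Otherwise a relation for the inverse of 1 - j, cleared of denominators, puts a
    power of 1 - j into J. Yet every power of 1 - j is congruent to 1 modulo J.\<close>
  have unit: "inverse (1 - j) \<in> W" if "j \<in> J" for j
  proof (rule ccontr)
    assume "inverse (1 - j) \<notin> W"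
    then obtain p where p: "p \<in> polys_over J" "poly p (inverse (1 - j)) = 1"
      using relation by blast
    have ne: "1 - j \<noteq> 0" using that WJ(5) by auto
    then have "poly (reflect_poly p) (1 - j) = (1 - j) ^ degree p"
      using poly_reflect_poly_nz[OF ne, of p] p(2) by simp
    moreover have "poly (reflect_poly p) (1 - j) \<in> J"
      unfolding poly_altdef
    proof (rule sum_closed[OF J(2,3)])
      fix i
      have "coeff (reflect_poly p) i \<in> J"
        using p(1) J(2) by (auto simp: coeff_reflect_poly polys_over_def)
      moreover have "(1 - j) ^ i \<in> W" using W J(1) that by auto
      ultimately show "coeff (reflect_poly p) i * (1 - j) ^ i \<in> J"
        using J(4) by (metis mult.commute)
    qed
    moreover have "1 - (1 - j) ^ n \<in> J" for n
    proof (induction n)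
      case (Suc n)
      have "1 - (1 - j) ^ Suc n = (1 - (1 - j) ^ n) + (1 - j) ^ n * j"
        by (simp add: algebra_simps)
      moreover have "(1 - j) ^ n * j \<in> J"
        using J(1) W(2,6) that by (intro J(4) W(7)) auto
      ultimately show ?case using Suc J(3) by metis
    qed (auto simp: J)
    ultimately have "(1 - (1 - j) ^ degree p) + (1 - j) ^ degree p \<in> J" by (intro J(3)) simp_all
    then show False using WJ by simp
  qed
  have "valuation_ring W"
    unfolding valuation_ring_def
  proof (intro conjI allI WJ(3))
    fix x
    show "x \<in> W \<or> inverse x \<in> W"
    proof (rule ccontr)
      assume *: "\<not> (x \<in> W \<or> inverse x \<in> W)"
      then have "x \<noteq> 0" using W by auto
      with * chevalley_no_relations[OF WJ(3-5) unit] relation[of x] relation[of "inverse x"]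
      show False by blast
    qed
  qed
  moreover have "inverse y \<notin> W" if "y \<in> I" "y \<noteq> 0" for y
  proof
    assume "inverse y \<in> W"
    then have "inverse y * y \<in> J" using that WJ(2) J(4) by blast
    then show False using WJ(5) that by simp
  qed
  ultimately show ?thesis using WJ(1) by blast
qed

text \<open>Put z = 1/y. If z were a non-unit of B[z], Chevalley's theorem for the ideal zB[z] would
  give a valuation ring over B that misses y. Hence 1 = p(z) z for some p over B, and multiplying by
  y^(d+1), with d the degree of p, yields the integral equation.\<close>

corollary integral_if_in_all_valuation_rings:
  fixes y :: "'f::field"
  assumes B: "subring B" and all: "\<And>W. valuation_ring W \<Longrightarrow> B \<subseteq> W \<Longrightarrow> y \<in> W"
  shows "\<exists>n c. (\<forall>i<n. c i \<in> B) \<and> y ^ n = (\<Sum>i<n. c i * y ^ i)"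
proof (cases "y = 0")
  case True
  then show ?thesis using subringD[OF B] by (intro exI[of _ 1] exI[of _ "\<lambda>_. 0"]) auto
next
  case False
  define z where "z = inverse y"
  have z: "z \<noteq> 0" "inverse z = y" using False by (auto simp: z_def)
  define R where "R = adjoin B z"
  define I where "I = (\<lambda>r. r * z) ` R"
  have R: "subring R" unfolding R_def by (rule subring_adjoin[OF B])
  note Rc = subringD[OF R]
  have zR: "z \<in> R" unfolding R_def using adjoin_generator subringD[OF B] by blast
  have I: "ideal_of R I"
    unfolding ideal_of_def I_def
  proof (intro conjI ballI)
    show "(\<lambda>r. r * z) ` R \<subseteq> R" using Rc(4) zR by auto
    show "0 \<in> (\<lambda>r. r * z) ` R" using Rc(1) by force
    fix a assume "a \<in> (\<lambda>r. r * z) ` R"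
    then obtain r where r: "a = r * z" "r \<in> R" by auto
    show "a + b \<in> (\<lambda>r. r * z) ` R" if "b \<in> (\<lambda>r. r * z) ` R" for b
      using that r Rc(3) by (auto simp flip: distrib_right)
    show "s * a \<in> (\<lambda>r. r * z) ` R" if "s \<in> R" for s
      using that r Rc(4) by (auto simp flip: mult.assoc)
  qed
  have "1 \<in> I"
  proof (rule ccontr)
    assume "1 \<notin> I"
    from chevalley_extension[OF R I this] obtain W where
      W: "valuation_ring W" "R \<subseteq> W" "\<And>y. y \<in> I \<Longrightarrow> y \<noteq> 0 \<Longrightarrow> inverse y \<notin> W" by blast
    have "z \<in> I" unfolding I_def using Rc(2) by force
    then have "y \<notin> W" using W(3)[of z] z by auto
    moreover have "B \<subseteq> W" using W(2) adjoin_superset subringD(1)[OF B] unfolding R_def by blast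
    ultimately show False using all W(1) by blast
  qed
  then obtain p where p: "p \<in> polys_over B" "1 = poly p z * z"
    unfolding I_def R_def adjoin_def by auto
  define d where "d = degree p"
  have "y ^ Suc d = y ^ Suc d * (poly p z * z)" using p by simp
  also have "\<dots> = y ^ d * poly p z" using False by (simp add: z_def field_simps)
  also have "\<dots> = (\<Sum>i\<le>d. coeff p i * (y ^ d * z ^ i))"
    by (simp add: poly_altdef d_def sum_distrib_left mult_ac)
  also have "\<dots> = (\<Sum>i\<le>d. coeff p i * y ^ (d - i))"
  proof (rule sum.cong)
    fix i assume "i \<in> {..d}"
    then have "y ^ d = y ^ (d - i) * y ^ i" by (simp flip: power_add)
    then show "coeff p i * (y ^ d * z ^ i) = coeff p i * y ^ (d - i)"
      using False by (simp add: z_def power_inverse field_simps)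
  qed simp
  also have "\<dots> = (\<Sum>i<Suc d. coeff p (d - i) * y ^ i)"
    unfolding lessThan_Suc_atMost by (subst sum.nat_diff_reindex[symmetric, of _ "Suc d", unfolded lessThan_Suc_atMost]) simp
  finally show ?thesis
    using p(1) by (intro exI[of _ "Suc d"] exI[of _ "\<lambda>i. coeff p (d - i)"]) (auto simp: polys_over_def)
qed

section \<open>The place at infinity\<close>

lemma polys_over_mono: "B \<subseteq> C \<Longrightarrow> polys_over B \<subseteq> polys_over C"
  by (auto simp: polys_over_def)

lemma poly_closed:
  assumes "subring R" "p \<in> polys_over R" "x \<in> R"
  shows "poly p x \<in> R"
  unfolding poly_altdef
proof (rule sum_closed[OF subringD(1,3)[OF assms(1)]])
  fix i
  have "coeff p i \<in> R" using assms(2) by (simp add: polys_over_def)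
  then show "coeff p i * x ^ i \<in> R" using subringD(4,7)[OF assms(1)] assms(3) by simp
qed

lemma synthetic_div_polys_over:
  assumes "subring F" "c \<in> F" "p \<in> polys_over F"
  shows "synthetic_div p c \<in> polys_over F"
  using assms(3)
proof (induction p)
  case 0
  then show ?case by simp
next
  case (pCons a p)
  have p: "p \<in> polys_over F"
    using pCons.prems by (auto simp: polys_over_def coeff_pCons split: nat.splits)
  have "poly p c \<in> F" using poly_closed[OF assms(1) p assms(2)] .
  with pCons.IH[OF p] show ?case
    by (auto simp: polys_over_def coeff_pCons split: nat.splits)
qed

text \<open>Over the algebraically closed F the polynomial splits into linear factors, and the prime
  N must contain one of them evaluated at h. This is used for the maximal ideal of V, for the zero
  ideal of A and for the maximal ideals of A.\<close>

lemma algebraic_residue_in_alg_closed: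
  fixes F :: "'f::field set"
  assumes F: "subring F" and ac: "\<And>p. p \<in> polys_over F \<Longrightarrow> degree p > 0 \<Longrightarrow> \<exists>c\<in>F. poly p c = 0"
    and R: "subring R" "F \<subseteq> R" and prime: "\<And>x y. x \<in> R \<Longrightarrow> y \<in> R \<Longrightarrow> x * y \<in> N \<Longrightarrow> x \<in> N \<or> y \<in> N"
    and triv: "\<And>x. x \<in> F \<Longrightarrow> x \<in> N \<Longrightarrow> x = 0"
    and "h \<in> R" "p \<in> polys_over F" "p \<noteq> 0" "poly p h \<in> N"
  shows "\<exists>c\<in>F. h - c \<in> N"
  using assms(8-)
proof (induction "degree p" arbitrary: p rule: less_induct)
  case less
  show ?case
  proof (cases "degree p = 0")
    case True
    then obtain a where a: "p = [:a:]" by (auto elim: degree_eq_zeroE)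
    have "a = 0"
    proof (rule triv)
      have "coeff p 0 \<in> F" using less.prems(1) by (auto simp: polys_over_def)
      then show "a \<in> F" using a by simp
      show "a \<in> N" using a less.prems by simp
    qed
    then show ?thesis using a less.prems by simp
  next
    case False
    then obtain c where c: "c \<in> F" "poly p c = 0" using ac less.prems by blast
    define q where "q = synthetic_div p c"
    have pq: "p = [:- c, 1:] * q" using synthetic_div_correct'[of c p] c by (simp add: q_def)
    have q: "q \<in> polys_over F" using synthetic_div_polys_over F c less.prems by (simp add: q_def)
    have "q \<noteq> 0" using pq less.prems by auto
    have "poly q h \<in> R"
      using poly_closed[OF R(1)] polys_over_mono[OF R(2)] q \<open>h \<in> R\<close> by blast
    moreover have "h - c \<in> R" using subringD(6)[OF R(1)] \<open>h \<in> R\<close> c R by blast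
    moreover have "poly p h = (h - c) * poly q h" unfolding pq by (simp add: algebra_simps)
    then have "(h - c) * poly q h \<in> N" using less.prems by simp
    ultimately consider "h - c \<in> N" | "poly q h \<in> N" using prime by blast
    then show ?thesis
    proof cases
      case 2
      have "degree q < degree p" using False by (simp add: q_def degree_synthetic_div)
      then show ?thesis using less.hyps q 2 \<open>q \<noteq> 0\<close> by blast
    qed (use c in auto)
  qed
qed

text \<open>Dropping the N-parts of the coefficients changes the integral equation only by an
  element of N, because N absorbs multiplication by y. What remains is monic over F.\<close>

lemma integral_modulo:
  fixes F N :: "'f::field set"
  assumes F: "subring F" and N: "0 \<in> N" "\<And>x y. x \<in> N \<Longrightarrow> y \<in> N \<Longrightarrow> x + y \<in> N" "\<And>x. x \<in> N \<Longrightarrow> y * x \<in> N"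
    and c: "\<forall>i<n. c i \<in> {f + v |f v. f \<in> F \<and> v \<in> N}" "y ^ n = (\<Sum>i<n. c i * y ^ i)"
  shows "\<exists>p\<in>polys_over F. lead_coeff p = 1 \<and> degree p = n \<and> poly p y \<in> N"
proof -
  have "\<forall>i\<in>{..<n}. \<exists>f. f \<in> F \<and> c i - f \<in> N" using c(1) by fastforce
  then obtain f where f: "\<And>i. i < n \<Longrightarrow> f i \<in> F" "\<And>i. i < n \<Longrightarrow> c i - f i \<in> N" by (auto simp: bchoice_iff)
  define p where "p = monom 1 n - (\<Sum>i<n. monom (f i) i)"
  have co: "coeff p i = (if i = n then 1 else if i < n then - f i else 0)" for i
    by (auto simp: p_def coeff_sum if_distrib[of uminus] sum.delta)
  have "degree p = n"
  proof (rule antisym)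
    show "degree p \<le> n" by (rule degree_le) (auto simp: co)
    show "n \<le> degree p" by (rule le_degree) (auto simp: co)
  qed
  moreover have "p \<in> polys_over F"
    using f(1) subringD[OF F] by (auto simp: polys_over_def co)
  moreover have "poly p y \<in> N"
  proof -
    have *: "v * y ^ k \<in> N" if "v \<in> N" for v k
    proof (induction k)
      case (Suc k)
      have "v * y ^ Suc k = y * (v * y ^ k)" by simp
      then show ?case using N(3)[OF Suc] by metis
    qed (use that in simp)
    have "poly p y = (\<Sum>i<n. (c i - f i) * y ^ i)"
      by (simp add: p_def poly_sum poly_monom c(2) left_diff_distrib sum_subtractf)
    then show ?thesis using f(2) * by (auto intro!: sum_closed N)
  qed
  ultimately show ?thesis using co[of n] by auto
qed

text \<open>F, A and V stand for k, O(C) and the valuation ring at infinity inside the function field.\<close>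
locale one_place =
  fixes F A V :: "'f::field set"
  assumes subring_F: "subring F" and inverse_F: "x \<in> F \<Longrightarrow> inverse x \<in> F"
    and alg_closed_F: "p \<in> polys_over F \<Longrightarrow> degree p > 0 \<Longrightarrow> \<exists>c\<in>F. poly p c = 0"
    and char_0: "n > 0 \<Longrightarrow> of_nat n \<noteq> (0::'f)"
    and subring_A: "subring A" and F_A: "F \<subseteq> A"
    and fractions: "\<exists>a\<in>A. \<exists>b\<in>A. b \<noteq> 0 \<and> z = a / b"
    and finitely_generated: "\<exists>S. finite S \<and> S \<subseteq> A \<and> (\<forall>M. subring M \<longrightarrow> F \<subseteq> M \<longrightarrow> S \<subseteq> M \<longrightarrow> A \<subseteq> M)"
    and V: "valuation_ring V" and F_V: "F \<subseteq> V" and A_V: "\<not> A \<subseteq> V"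
    and unique: "valuation_ring W \<Longrightarrow> F \<subseteq> W \<Longrightarrow> \<not> A \<subseteq> W \<Longrightarrow> W = V"
begin

section \<open>Pole orders at infinity as a preorder given by divisibility in V\<close>

lemmas F = subringD[OF subring_F]
lemmas A = subringD[OF subring_A]

lemma subring_V: "subring V" using V by (simp add: valuation_ring_def)
lemmas Vr = subringD[OF subring_V]

lemma F_in_A: "c \<in> F \<Longrightarrow> c \<in> A" using F_A by blast

text \<open>The preorder "the pole order of a is at most that of b".\<close>
definition le :: "'f \<Rightarrow> 'f \<Rightarrow> bool" where "le a b \<longleftrightarrow> (\<exists>v\<in>V. a = v * b)"

definition lt :: "'f \<Rightarrow> 'f \<Rightarrow> bool" where "lt a b \<longleftrightarrow> \<not> le b a"

definition same :: "'f \<Rightarrow> 'f \<Rightarrow> bool" where "same a b \<longleftrightarrow> le a b \<and> le b a"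

lemma le_1: "le a 1 \<longleftrightarrow> a \<in> V" by (auto simp: le_def)
lemma le_0 [simp]: "le 0 a" using Vr(1) by (force simp: le_def)
lemma le_0_right [simp]: "le a 0 \<longleftrightarrow> a = 0" using Vr(1) by (auto simp: le_def)
lemma le_refl [simp]: "le a a" using Vr(2) unfolding le_def by (intro bexI[of _ 1]) auto

lemma le_trans: "le a b \<Longrightarrow> le b c \<Longrightarrow> le a c"
  unfolding le_def
proof clarify
  fix v w assume "v \<in> V" "w \<in> V"
  then show "\<exists>u\<in>V. v * (w * c) = u * c" using Vr(4) by (intro bexI[of _ "v * w"]) auto
qed

lemma le_divide: "b \<noteq> 0 \<Longrightarrow> le a b \<longleftrightarrow> a / b \<in> V"
  by (auto simp: le_def intro!: bexI[of _ "a / b"])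

lemma le_total: "le a b \<or> le b a"
proof (cases "a = 0 \<or> b = 0")
  case False
  then show ?thesis
    using V inverse_divide[of a b] by (auto simp: le_divide valuation_ring_def)
qed auto

lemma le_mult: "le a b \<Longrightarrow> le c d \<Longrightarrow> le (a * c) (b * d)"
  unfolding le_def
proof clarify
  fix v w assume "v \<in> V" "w \<in> V"
  then show "\<exists>u\<in>V. v * b * (w * d) = u * (b * d)"
    using Vr(4) by (intro bexI[of _ "v * w"]) auto
qed

lemma le_power: "le a b \<Longrightarrow> le (a ^ n) (b ^ n)"
  by (induction n) (auto intro: le_mult)

lemma le_cancel [simp]: "c \<noteq> 0 \<Longrightarrow> le (a * c) (b * c) \<longleftrightarrow> le a b"
  by (auto simp: le_def)

lemma le_cancel_left [simp]: "c \<noteq> 0 \<Longrightarrow> le (c * a) (c * b) \<longleftrightarrow> le a b"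
  using le_cancel[of c a b] by (simp add: mult.commute)

lemma le_add: "le a c \<Longrightarrow> le b c \<Longrightarrow> le (a + b) c"
  unfolding le_def
proof clarify
  fix v w assume "v \<in> V" "w \<in> V"
  then show "\<exists>u\<in>V. v * c + w * c = u * c"
    using Vr(3) by (intro bexI[of _ "v + w"]) (auto simp: distrib_right)
qed

lemma le_uminus [simp]: "le (- a) b \<longleftrightarrow> le a b"
proof -
  have "le (- x) b" if "le x b" for x
    using that Vr(5) unfolding le_def by (elim bexE) (auto intro!: bexI[of _ "- v" for v])
  from this[of a] this[of "- a"] show ?thesis by auto
qed

lemma le_uminus_right [simp]: "le a (- b) \<longleftrightarrow> le a b"
proof -
  have "le b (- b)" "le (- b) b" using le_uminus[of "- b" "- b"] by simp_all
  then show ?thesis using le_trans by blast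
qed

lemma lt_imp_le: "lt a b \<Longrightarrow> le a b" using le_total by (auto simp: lt_def)
lemma lt_irrefl [simp]: "\<not> lt a a" by (simp add: lt_def)
lemma le_lt_trans: "le a b \<Longrightarrow> lt b c \<Longrightarrow> lt a c" unfolding lt_def using le_trans by blast
lemma lt_le_trans: "lt a b \<Longrightarrow> le b c \<Longrightarrow> lt a c" unfolding lt_def using le_trans by blast
lemma lt_trans: "lt a b \<Longrightarrow> lt b c \<Longrightarrow> lt a c" using lt_le_trans lt_imp_le by blast
lemma lt_nonzero: "lt a b \<Longrightarrow> b \<noteq> 0" by (auto simp: lt_def)
lemma lt_0: "lt 0 b \<longleftrightarrow> b \<noteq> 0" by (auto simp: lt_def)
lemma lt_cancel [simp]: "c \<noteq> 0 \<Longrightarrow> lt (a * c) (b * c) \<longleftrightarrow> lt a b" by (simp add: lt_def)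
lemma lt_cancel_left [simp]: "c \<noteq> 0 \<Longrightarrow> lt (c * a) (c * b) \<longleftrightarrow> lt a b" by (simp add: lt_def)
lemma lt_uminus [simp]: "lt (- a) b \<longleftrightarrow> lt a b" by (simp add: lt_def)

lemma lt_add: "lt a c \<Longrightarrow> lt b c \<Longrightarrow> lt (a + b) c"
  using le_total[of a b] le_add[of a b b] le_add[of a a b] le_lt_trans by auto

lemma lt_diff: "lt a c \<Longrightarrow> lt b c \<Longrightarrow> lt (a - b) c"
  using lt_add[of a c "- b"] by simp

lemma lt_mult: "lt a b \<Longrightarrow> le c d \<Longrightarrow> d \<noteq> 0 \<Longrightarrow> lt (a * c) (b * d)"
  using le_lt_trans[OF le_mult[OF le_refl[of a], of c d], of "b * d"] lt_cancel[of d a b] by simp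

lemma lt_power: "lt a b \<Longrightarrow> n > 0 \<Longrightarrow> lt (a ^ n) (b ^ n)"
proof (induction n)
  case (Suc n)
  then show ?case
    using lt_mult[of a b "a ^ n" "b ^ n"] le_power[OF lt_imp_le] lt_nonzero by simp
qed simp

lemma same_refl [simp]: "same a a" by (simp add: same_def)
lemma same_sym: "same a b \<Longrightarrow> same b a" by (simp add: same_def)
lemma same_trans: "same a b \<Longrightarrow> same b c \<Longrightarrow> same a c" unfolding same_def using le_trans by blast
lemma same_mult: "same a b \<Longrightarrow> same c d \<Longrightarrow> same (a * c) (b * d)" by (simp add: same_def le_mult)
lemma same_power: "same a b \<Longrightarrow> same (a ^ n) (b ^ n)" by (simp add: same_def le_power)
lemma same_zero: "same a b \<Longrightarrow> a = 0 \<longleftrightarrow> b = 0" by (auto simp: same_def)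

lemma F_le_1: "c \<in> F \<Longrightarrow> le c 1" using F_V by (auto simp: le_1)

lemma F_same_1: "c \<in> F \<Longrightarrow> c \<noteq> 0 \<Longrightarrow> same c 1"
proof -
  assume c: "c \<in> F" "c \<noteq> 0"
  have "le 1 c" using c F_V inverse_F by (auto simp: le_divide inverse_eq_divide[symmetric])
  then show ?thesis using c F_le_1 by (simp add: same_def)
qed

lemma F_scale: "c \<in> F \<Longrightarrow> le (c * a) a" using le_mult[OF F_le_1 le_refl] by fastforce

lemma F_scale_same: "c \<in> F \<Longrightarrow> c \<noteq> 0 \<Longrightarrow> same (c * a) a"
  using same_mult[OF F_same_1 same_refl] by fastforce

lemma of_nat_F: "of_nat n \<in> F" by (rule F(8))

text \<open>A second valuation ring over F either equals V or contains A, so elements lying in all of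
  them are integral over F or a ring close to it.\<close>

lemma residue:
  assumes "h \<in> V" shows "\<exists>c\<in>F. lt (h - c) 1"
proof -
  \<comment> \<open>N is the maximal ideal of V. It suffices that h is integral over B = F + N:
    reducing modulo N gives a polynomial over F with value in N, one of whose roots in F is the
    wanted residue.\<close>
  define N where "N = {v. lt v 1}"
  define B where "B = {f + v |f v. f \<in> F \<and> v \<in> N}"
  have N: "0 \<in> N" "\<And>x y. x \<in> N \<Longrightarrow> y \<in> N \<Longrightarrow> x + y \<in> N" "\<And>x y. y \<in> V \<Longrightarrow> x \<in> N \<Longrightarrow> y * x \<in> N"
    "\<And>x. x \<in> N \<Longrightarrow> - x \<in> N" "N \<subseteq> V"
    using lt_mult[of _ 1 _ 1] by (auto simp: N_def lt_0 lt_add le_1 mult.commute dest!: lt_imp_le)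
  have "subring B"
    unfolding subring_def
  proof (intro conjI ballI)
    show "0 \<in> B" "1 \<in> B" using N(1) F(1,2) by (force simp: B_def)+
    fix a b assume "a \<in> B" "b \<in> B"
    then obtain f v g w where *: "a = f + v" "b = g + w" "f \<in> F" "g \<in> F" "v \<in> N" "w \<in> N"
      by (auto simp: B_def)
    have "a + b = (f + g) + (v + w)" using * by simp
    then show "a + b \<in> B" using * N(2) F(3) unfolding B_def by blast
    have "a * b = f * g + (f * w + (g * v + v * w))" using * by (simp add: algebra_simps)
    moreover have "f * w + (g * v + v * w) \<in> N" using * N(2,3,5) F_V by (meson subsetD)
    ultimately show "a * b \<in> B" using * F(4) unfolding B_def by blast
    have "- a = (- f) + (- v)" using * by simp
    then show "- a \<in> B" using * N(4) F(5) unfolding B_def by blast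
  qed
  \<comment> \<open>If W contains A, choose x in A with a pole: h/x lies in N, hence in W, and
    multiplying by x recovers h. If not, W is V itself, which contains h.\<close>
  moreover have "h \<in> W" if W: "valuation_ring W" "B \<subseteq> W" for W
  proof (cases "A \<subseteq> W")
    case True
    obtain x where x: "x \<in> A" "x \<notin> V" using A_V by blast
    have "lt 1 x" using x by (simp add: lt_def le_1)
    then have "x \<noteq> 0" by (rule lt_nonzero)
    have "lt h x" using assms \<open>lt 1 x\<close> le_1 le_lt_trans by blast
    then have "lt (h / x) 1" using lt_cancel[OF \<open>x \<noteq> 0\<close>, of "h / x" 1] \<open>x \<noteq> 0\<close> by simp
    then have "0 + h / x \<in> B" unfolding B_def N_def using F(1) by blast
    then have "h / x * x \<in> W" using W x True by (metis add_0 subsetD subringD(4) valuation_ring_def)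
    then show ?thesis using \<open>x \<noteq> 0\<close> by simp
  next
    case False
    have "F \<subseteq> B" using N(1) by (force simp: B_def)
    then show ?thesis using unique[OF W(1) _ False] W assms by blast
  qed
  ultimately obtain n c where c: "\<forall>i<n. c i \<in> B" "h ^ n = (\<Sum>i<n. c i * h ^ i)"
    using integral_if_in_all_valuation_rings by blast
  obtain p where p: "p \<in> polys_over F" "lead_coeff p = 1" "poly p h \<in> N"
    using integral_modulo[OF subring_F N(1,2) N(3)[OF assms] c(1)[unfolded B_def] c(2)] by blast
  have "\<exists>c\<in>F. h - c \<in> N"
  proof (rule algebraic_residue_in_alg_closed[OF subring_F alg_closed_F subring_V F_V _ _ assms p(1) _ p(3)])
    show "x \<in> N \<or> y \<in> N" if "x * y \<in> N" for x y
      using that le_mult[of 1 x 1 y] by (auto simp: N_def lt_def)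
    show "x = 0" if "x \<in> F" "x \<in> N" for x
      using that F_same_1 by (auto simp: N_def lt_def same_def)
    show "p \<noteq> 0" using p(2) by auto
  qed auto
  then show ?thesis by (simp add: N_def)
qed

text \<open>A function regular on C and at infinity lies in every valuation ring over F, so it is
  integral over F, hence constant because F is algebraically closed.\<close>

lemma A_Int_V: assumes "y \<in> A" "y \<in> V" shows "y \<in> F"
proof -
  have "y \<in> W" if "valuation_ring W" "F \<subseteq> W" for W using unique[OF that] assms by blast
  then obtain n c where c: "\<forall>i<n. c i \<in> F" "y ^ n = (\<Sum>i<n. c i * y ^ i)"
    using integral_if_in_all_valuation_rings[OF subring_F] by blast
  have "\<forall>i<n. c i \<in> {f + v |f v. f \<in> F \<and> v \<in> {0}}" using c(1) by auto
  then obtain p where p: "p \<in> polys_over F" "lead_coeff p = 1" "poly p y \<in> {0}"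
    using integral_modulo[OF subring_F _ _ _ _ c(2), of "{0}"] by auto
  have "p \<noteq> 0" using p(2) by auto
  then obtain d where "d \<in> F" "y - d = 0"
    using algebraic_residue_in_alg_closed[OF subring_F alg_closed_F subring_A F_A _ _ assms(1) p(1) _ p(3)]
    by auto
  then show ?thesis by simp
qed

text \<open>A valuation ring over F + xA cannot be V, since x has a pole there, so it contains A.
  Thus a is integral over F + xA, and reducing the coefficients modulo xA gives the polynomial over
  F.\<close>

lemma algebraic_modulo:
  assumes a: "a \<in> A" and x: "x \<in> A" "x \<notin> V"
  shows "\<exists>p\<in>polys_over F. lead_coeff p = 1 \<and> (\<exists>b\<in>A. poly p a = x * b)"
proof -
  define N where "N = (*) x ` A"
  define B where "B = {f + v |f v. f \<in> F \<and> v \<in> N}"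
  have N: "0 \<in> N" "\<And>u v. u \<in> N \<Longrightarrow> v \<in> N \<Longrightarrow> u + v \<in> N" "\<And>u v. v \<in> A \<Longrightarrow> u \<in> N \<Longrightarrow> v * u \<in> N"
    "\<And>u. u \<in> N \<Longrightarrow> - u \<in> N" "N \<subseteq> A" "x \<in> N"
  proof -
    show "0 \<in> N" using A(1) by (force simp: N_def)
    show "x \<in> N" using A(2) by (force simp: N_def)
    show "N \<subseteq> A" using A(4) x by (auto simp: N_def)
    show "u + v \<in> N" if "u \<in> N" "v \<in> N" for u v
      using that A(3) by (auto simp: N_def simp flip: distrib_left)
    show "v * u \<in> N" if vu: "v \<in> A" "u \<in> N" for u v
    proof -
      obtain b where "b \<in> A" "u = x * b" using vu by (auto simp: N_def)
      then show ?thesis using vu A(4) unfolding N_def by (intro image_eqI[of _ _ "v * b"]) auto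
    qed
    then show "- u \<in> N" if "u \<in> N" for u using that A(2,5) by (metis mult_minus1)
  qed
  have "subring B"
    unfolding subring_def
  proof (intro conjI ballI)
    show "0 \<in> B" "1 \<in> B" using N(1) F(1,2) by (force simp: B_def)+
    fix a b assume "a \<in> B" "b \<in> B"
    then obtain f v g w where *: "a = f + v" "b = g + w" "f \<in> F" "g \<in> F" "v \<in> N" "w \<in> N"
      by (auto simp: B_def)
    have "a + b = (f + g) + (v + w)" using * by simp
    then show "a + b \<in> B" using * N(2) F(3) unfolding B_def by blast
    have "a * b = f * g + (f * w + (g * v + v * w))" using * by (simp add: algebra_simps)
    moreover have "f * w + (g * v + v * w) \<in> N" using * N(2,3,5) F_A by (meson subsetD)
    ultimately show "a * b \<in> B" using * F(4) unfolding B_def by blast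
    have "- a = (- f) + (- v)" using * by simp
    then show "- a \<in> B" using * N(4) F(5) unfolding B_def by blast
  qed
  moreover have "a \<in> W" if W: "valuation_ring W" "B \<subseteq> W" for W
  proof (rule ccontr)
    assume "a \<notin> W"
    moreover have "F \<subseteq> B" using N(1) by (force simp: B_def)
    ultimately have "W = V" using unique[OF W(1)] W a by blast
    moreover have "0 + x \<in> B" unfolding B_def using F(1) N(6) by blast
    ultimately show False using x W by auto
  qed
  ultimately obtain n c where c: "\<forall>i<n. c i \<in> B" "a ^ n = (\<Sum>i<n. c i * a ^ i)"
    using integral_if_in_all_valuation_rings by blast
  show ?thesis
    using integral_modulo[OF subring_F N(1,2) N(3)[OF a] c(1)[unfolded B_def] c(2)]
    by (auto simp: N_def)
qed

lemma powers_mono: "lt 1 x \<Longrightarrow> n \<le> m \<Longrightarrow> le (x ^ n) (x ^ m)"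
proof -
  assume x: "lt 1 x" "n \<le> m"
  have "le (x ^ n * 1 ^ (m - n)) (x ^ n * x ^ (m - n))"
    by (intro le_mult le_power le_refl lt_imp_le x)
  then show ?thesis using x by (simp flip: power_add)
qed

text \<open>The elements dominated by some power of x form a coarser valuation ring, and uniqueness of V
  forces it to be the whole field.\<close>
lemma archimedean:
  assumes "lt 1 x" shows "\<exists>n. le h (x ^ n)"
proof -
  have x: "x \<noteq> 0" "x \<notin> V" using assms lt_nonzero[OF assms] by (auto simp: lt_def le_1)
  define W where "W = {h. \<exists>n. le h (x ^ n)}"
  note mono = powers_mono[OF assms]
  have VW: "V \<subseteq> W"
  proof
    fix v assume "v \<in> V"
    then have "le v (x ^ 0)" by (simp add: le_1)
    then show "v \<in> W" unfolding W_def by blast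
  qed
  have W: "valuation_ring W"
    unfolding valuation_ring_def subring_def
  proof (intro conjI ballI allI)
    show "0 \<in> W" "1 \<in> W" using VW Vr(1,2) by auto
    fix a b assume "a \<in> W" "b \<in> W"
    then obtain n m where nm: "le a (x ^ n)" "le b (x ^ m)" by (auto simp: W_def)
    have "le (a + b) (x ^ max n m)"
      using le_add le_trans[OF nm(1) mono[of n "max n m"]] le_trans[OF nm(2) mono[of m "max n m"]] by simp
    then show "a + b \<in> W" by (auto simp: W_def)
    have "le (a * b) (x ^ (n + m))" using le_mult[OF nm] by (simp add: power_add)
    then show "a * b \<in> W" by (auto simp: W_def)
    show "- a \<in> W" using nm by (auto simp: W_def)
  next
    fix a show "a \<in> W \<or> inverse a \<in> W" using V VW by (auto simp: valuation_ring_def)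
  qed
  note Wr = subringD[OF conjunct1[OF W[unfolded valuation_ring_def]]]
  have "le x (x ^ 1)" by simp
  then have "x \<in> W" unfolding W_def by blast
  then have "A \<subseteq> W" using unique[OF W] F_V VW x by blast
  \<comment> \<open>W contains A since it contains x and so differs from V. For all fractions only
    inverses of elements of A are missing: an element without a pole is constant, and one with a
    pole has its inverse in V.\<close>
  have inv: "inverse b \<in> W" if "b \<in> A" for b
  proof (cases "b \<in> V")
    case True
    then have "inverse b \<in> F" using A_Int_V inverse_F that by blast
    then show ?thesis using F_V VW by blast
  next
    case False
    then show ?thesis using V VW by (auto simp: valuation_ring_def)
  qed
  obtain a b where "a \<in> A" "b \<in> A" "h = a * inverse b"
    using fractions[of h] by (auto simp: divide_inverse)
  then have "h \<in> W" using Wr(4) inv \<open>A \<subseteq> W\<close> by blast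
  then show ?thesis by (simp add: W_def)
qed

lemma nonconst_iff: "a \<in> A \<Longrightarrow> lt 1 a \<longleftrightarrow> a \<notin> F"
  using A_Int_V F_V by (auto simp: lt_def le_1)

lemma A_ge_1: "a \<in> A \<Longrightarrow> a \<noteq> 0 \<Longrightarrow> le 1 a"
  using nonconst_iff F_same_1 lt_imp_le by (auto simp: same_def)

text \<open>The constant c is the residue of a/b. Subtracting \<open>c * b\<close> cancels the
  leading term of a, as a power series expansion at infinity would.\<close>

lemma leading_coefficient:
  assumes "le a b" "b \<noteq> 0" shows "\<exists>c\<in>F. lt (a - c * b) b"
proof -
  obtain c where c: "c \<in> F" "lt (a / b - c) 1" using residue assms le_divide by blast
  have "lt ((a / b - c) * b) (1 * b)" using c assms(2) lt_cancel by blast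
  then show ?thesis using c assms(2) by (auto simp: left_diff_distrib)
qed

end

section \<open>Finiteness of the set of pole orders\<close>

text \<open>The F-span of B modulo N, described without quotient spaces. With \<open>N = {0}\<close>
  and B the set of powers of t it is the polynomial ring F[t].\<close>

inductive_set fspan :: "'a::comm_ring_1 set \<Rightarrow> 'a set \<Rightarrow> 'a set \<Rightarrow> 'a set" for F B N where
  base: "v \<in> N \<Longrightarrow> v \<in> fspan F B N"
| scale: "c \<in> F \<Longrightarrow> b \<in> B \<Longrightarrow> c * b \<in> fspan F B N"
| add: "v \<in> fspan F B N \<Longrightarrow> w \<in> fspan F B N \<Longrightarrow> v + w \<in> fspan F B N"

lemma fspan_mult:
  assumes "v \<in> fspan F B N" "\<And>n. n \<in> N \<Longrightarrow> s * n \<in> fspan F C N"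
    and "\<And>c b. c \<in> F \<Longrightarrow> b \<in> B \<Longrightarrow> s * (c * b) \<in> fspan F C N"
  shows "s * v \<in> fspan F C N"
  using assms(1) by induction (auto simp: distrib_left intro: fspan.add assms(2,3))

lemma fspan_sum:
  assumes "0 \<in> N" "\<And>i. i \<in> I \<Longrightarrow> f i \<in> fspan F B N" shows "sum f I \<in> fspan F B N"
  using assms by (intro sum_closed) (auto intro: fspan.base fspan.add)

lemma fspan_coefficients:
  assumes "v \<in> fspan F B N" "finite B" "subring F" "0 \<in> N" "\<And>x y. x \<in> N \<Longrightarrow> y \<in> N \<Longrightarrow> x + y \<in> N"
  shows "\<exists>c. (\<forall>b\<in>B. c b \<in> F) \<and> v - (\<Sum>b\<in>B. c b * b) \<in> N"
  using assms(1)
proof induction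
  case (base v)
  then show ?case using subringD(1)[OF assms(3)] by (intro exI[of _ "\<lambda>_. 0"]) auto
next
  case (scale c b)
  then have "(\<Sum>b'\<in>B. (if b' = b then c else 0) * b') = c * b"
    using assms(2) by (simp add: if_distrib[of "\<lambda>x. x * _"] sum.delta cong: if_cong)
  then show ?case
    using scale assms(4) subringD(1)[OF assms(3)] by (intro exI[of _ "\<lambda>b'. if b' = b then c else 0"]) auto
next
  case (add v w)
  then obtain c d where c: "\<forall>b\<in>B. c b \<in> F" "v - (\<Sum>b\<in>B. c b * b) \<in> N"
    and d: "\<forall>b\<in>B. d b \<in> F" "w - (\<Sum>b\<in>B. d b * b) \<in> N" by blast
  have eq: "v + w - (\<Sum>b\<in>B. (c b + d b) * b) = (v - (\<Sum>b\<in>B. c b * b)) + (w - (\<Sum>b\<in>B. d b * b))"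
    by (simp add: distrib_right sum.distrib)
  have "v + w - (\<Sum>b\<in>B. (c b + d b) * b) \<in> N" unfolding eq by (rule assms(5)[OF c(2) d(2)])
  then show ?case
    using c(1) d(1) subringD(3)[OF assms(3)] by (intro exI[of _ "\<lambda>b. c b + d b"]) simp
qed

text \<open>Gaussian elimination modulo N: more vectors than spanning elements must be dependent.
  The vectors form an indexed family, because elimination changes them and may make some
  coincide.\<close>

lemma linear_dependence_modulo:
  fixes F N :: "'f::field set" and v :: "'i \<Rightarrow> 'f"
  assumes "finite B" "finite I" "card B < card I"
    and F: "subring F" "\<And>x. x \<in> F \<Longrightarrow> inverse x \<in> F"
    and N: "0 \<in> N" "\<And>x y. x \<in> N \<Longrightarrow> y \<in> N \<Longrightarrow> x + y \<in> N" "\<And>c x. c \<in> F \<Longrightarrow> x \<in> N \<Longrightarrow> c * x \<in> N"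
    and c: "\<And>i b. i \<in> I \<Longrightarrow> b \<in> B \<Longrightarrow> c i b \<in> F" "\<And>i. i \<in> I \<Longrightarrow> v i - (\<Sum>b\<in>B. c i b * b) \<in> N"
  shows "\<exists>d. (\<forall>i\<in>I. d i \<in> F) \<and> (\<exists>i\<in>I. d i \<noteq> 0) \<and> (\<Sum>i\<in>I. d i * v i) \<in> N"
  using assms(1-3) c
proof (induction B arbitrary: I v c rule: finite_induct)
  case empty
  then have "I \<noteq> {}" by auto
  then show ?case
    using empty subringD(2)[OF F(1)] by (intro exI[of _ "\<lambda>_. 1"]) (auto intro!: sum_closed N)
next
  case (insert b B)
  note Fr = subringD[OF F(1)]
  show ?case
  proof (cases "\<forall>i\<in>I. c i b = 0")
    case True
    then have "v i - (\<Sum>b\<in>B. c i b * b) \<in> N" if "i \<in> I" for i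
      using insert.prems(4)[OF that] insert.hyps that by simp
    then show ?thesis
      using insert.prems insert.hyps by (intro insert.IH[of I c v]) auto
  next
    case False
    then obtain k where k: "k \<in> I" "c k b \<noteq> 0" by blast
    \<comment> \<open>The vector with index k is the pivot; subtracting \<open>r i\<close> times it
      removes b from the expansion of every other vector.\<close>
    define r where "r i = c i b / c k b" for i
    have r: "r i \<in> F" if "i \<in> I" for i
      using insert.prems(3) k that F(2) Fr(4) by (simp add: r_def divide_inverse)
    define w where "w i = v i - r i * v k" for i
    define c' where "c' i b' = c i b' - r i * c k b'" for i b'
    have "\<exists>d. (\<forall>i\<in>I - {k}. d i \<in> F) \<and> (\<exists>i\<in>I - {k}. d i \<noteq> 0) \<and> (\<Sum>i\<in>I - {k}. d i * w i) \<in> N"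
    proof (rule insert.IH[where c = c'])
      show "finite (I - {k})" using insert.prems by simp
      show "card B < card (I - {k})" using insert.prems insert.hyps k by simp
      show "c' i b' \<in> F" if "i \<in> I - {k}" "b' \<in> B" for i b'
        using that insert.prems(3) k r Fr(4,6) by (simp add: c'_def)
      show "w i - (\<Sum>b'\<in>B. c' i b' * b') \<in> N" if i: "i \<in> I - {k}" for i
      proof -
        have "- 1 * r i \<in> F" using r i Fr(2,4,5) by (metis DiffD1)
        then have "(v i - (\<Sum>b'\<in>insert b B. c i b' * b')) + (- 1 * r i) * (v k - (\<Sum>b'\<in>insert b B. c k b' * b')) \<in> N"
          using i k insert.prems(4) by (intro N) auto
        moreover have rb: "c i b * b = r i * (c k b * b)" using k by (simp add: r_def)
        have "(\<Sum>b'\<in>B. c' i b' * b') = (\<Sum>b'\<in>B. c i b' * b') - r i * (\<Sum>b'\<in>B. c k b' * b')"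
          by (simp add: c'_def left_diff_distrib sum_subtractf sum_distrib_left mult.assoc)
        then have "w i - (\<Sum>b'\<in>B. c' i b' * b') =
            (v i - (c i b * b + (\<Sum>b'\<in>B. c i b' * b'))) + (- 1 * r i) * (v k - (c k b * b + (\<Sum>b'\<in>B. c k b' * b')))"
          unfolding rb w_def by (simp add: right_diff_distrib distrib_left)
        ultimately show ?thesis using insert.hyps by simp
      qed
    qed
    then obtain d where d: "\<forall>i\<in>I - {k}. d i \<in> F" "\<exists>i\<in>I - {k}. d i \<noteq> 0"
      "(\<Sum>i\<in>I - {k}. d i * w i) \<in> N" by blast
    \<comment> \<open>The coefficient at k is chosen so that the combination of the original vectors
      equals the combination of the reduced ones.\<close>
    define e where "e i = (if i = k then - (\<Sum>i\<in>I - {k}. d i * r i) else d i)" for i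
    have "(\<Sum>i\<in>I. e i * v i) = e k * v k + (\<Sum>i\<in>I - {k}. d i * v i)"
      using k insert.prems by (subst sum.remove[of _ k]) (auto simp: e_def intro!: sum.cong)
    also have "\<dots> = (\<Sum>i\<in>I - {k}. d i * w i)"
      by (simp add: e_def w_def right_diff_distrib sum_subtractf sum_distrib_right mult.assoc)
    finally have "(\<Sum>i\<in>I. e i * v i) \<in> N" using d(3) by simp
    moreover have "(\<Sum>i\<in>I - {k}. d i * r i) \<in> F"
      using d(1) r Fr(4) by (intro sum_closed Fr(1,3)) auto
    then have "e i \<in> F" if "i \<in> I" for i
      using d(1) that Fr(5) by (simp add: e_def)
    moreover have "\<exists>i\<in>I. e i \<noteq> 0" using d(2) by (auto simp: e_def)
    ultimately show ?thesis by blast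
  qed
qed

section \<open>Pole orders: finitely many generators, well-ordering, commensurability\<close>

context one_place
begin

lemma same_add: "lt a b \<Longrightarrow> same (a + b) b"
proof -
  assume ab: "lt a b"
  have "lt ((a + b) - a) b" if "lt (a + b) b" using lt_diff[OF that ab] .
  then have "le b (a + b)" by (auto simp: lt_def)
  then show ?thesis using le_add[OF lt_imp_le[OF ab] le_refl] by (simp add: same_def)
qed

text \<open>Terms of pairwise different pole orders cannot cancel, so the term of largest order
  determines the order of the sum.\<close>

lemma same_sum:
  assumes "finite I" "I \<noteq> {}" "\<And>i j. i \<in> I \<Longrightarrow> j \<in> I \<Longrightarrow> i \<noteq> j \<Longrightarrow> \<not> same (w i) (w j)"
  shows "\<exists>i\<in>I. same (\<Sum>i\<in>I. w i) (w i)"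
  using assms
proof (induction rule: finite_ne_induct)
  case (insert i I)
  then obtain j where j: "j \<in> I" "same (\<Sum>i\<in>I. w i) (w j)" by blast
  have "\<not> same (w i) (w j)" using insert.prems insert.hyps j by blast
  then consider "lt (w i) (w j)" | "lt (w j) (w i)" by (auto simp: same_def lt_def)
  then show ?case
  proof cases
    case 1
    then have "lt (w i) (\<Sum>i\<in>I. w i)" using j lt_le_trans by (auto simp: same_def)
    then have "same (w i + (\<Sum>i\<in>I. w i)) (w j)" using j same_add same_trans by blast
    then show ?thesis using insert.hyps j by auto
  next
    case 2
    then have "lt (\<Sum>i\<in>I. w i) (w i)" using j le_lt_trans by (auto simp: same_def)
    from same_add[OF this] have "same (w i + (\<Sum>i\<in>I. w i)) (w i)" by (simp add: add.commute)
    then show ?thesis using insert.hyps by auto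
  qed
qed simp

lemma ideal_multiples:
  assumes "x \<in> A"
  shows "0 \<in> (*) x ` A" "\<And>u v. u \<in> (*) x ` A \<Longrightarrow> v \<in> (*) x ` A \<Longrightarrow> u + v \<in> (*) x ` A"
    "\<And>a u. a \<in> A \<Longrightarrow> u \<in> (*) x ` A \<Longrightarrow> a * u \<in> (*) x ` A"
proof -
  show "0 \<in> (*) x ` A" using A(1) by force
  show "u + v \<in> (*) x ` A" if "u \<in> (*) x ` A" "v \<in> (*) x ` A" for u v
    using that A(3) by (auto simp flip: distrib_left)
  show "a * u \<in> (*) x ` A" if a: "a \<in> A" "u \<in> (*) x ` A" for a u
  proof -
    obtain b where "b \<in> A" "u = x * b" using a by auto
    then show ?thesis using a A(4) by (intro image_eqI[of _ _ "a * b"]) auto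
  qed
qed

text \<open>Each new generator s satisfies a monic equation modulo xA, of degree m say. The products
  b s^i with i < m then span a space stable under s, because b s^m can be rewritten, and still
  stable under the earlier generators.\<close>

lemma finite_span_stable:
  assumes x: "x \<in> A" "x \<notin> V" and "finite S" "S \<subseteq> A"
  shows "\<exists>B. finite B \<and> 1 \<in> B \<and> (\<forall>s\<in>S. \<forall>b\<in>B. s * b \<in> fspan F B ((*) x ` A)) \<and> B \<subseteq> A"
  using assms(3,4)
proof (induction S rule: finite_induct)
  case empty
  then show ?case using A by (intro exI[of _ "{1}"]) auto
next
  case (insert s S)
  define N where "N = (*) x ` A"
  note N = ideal_multiples[OF x(1), folded N_def]
  obtain B where B: "finite B" "1 \<in> B" "\<And>s b. s \<in> S \<Longrightarrow> b \<in> B \<Longrightarrow> s * b \<in> fspan F B N" "B \<subseteq> A"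
    using insert by (auto simp: N_def)
  have s: "s \<in> A" using insert.prems by simp
  obtain p0 where p0: "p0 \<in> polys_over F" "lead_coeff p0 = 1" "poly p0 s \<in> N"
    using algebraic_modulo[OF s x] by (auto simp: N_def)
  \<comment> \<open>The extra factor of the variable makes the degree m positive, so that the
    exponent 0 is available and 1 remains in the enlarged set C.\<close>
  define p m where "p = pCons 0 p0" and "m = Suc (degree p0)"
  have "p0 \<noteq> 0" using p0(2) by auto
  then have p: "degree p = m" "coeff p m = 1" "\<And>i. coeff p i \<in> F" "poly p s \<in> N"
    using p0 F(1) N(3)[OF s] by (auto simp: p_def m_def polys_over_def coeff_pCons split: nat.split)
  define C where "C = (\<lambda>(b, i). b * s ^ i) ` (B \<times> {..<m})"
  have C: "b * s ^ i \<in> C" if "b \<in> B" "i < m" for b i using that by (auto simp: C_def)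
  have CA: "C \<subseteq> A" using B(4) s A(4,7) by (auto simp: C_def)
  have *: "v * s ^ i \<in> fspan F C N" if "v \<in> fspan F B N" "i < m" for v i
  proof -
    have "s ^ i * v \<in> fspan F C N"
    proof (rule fspan_mult[OF that(1)])
      show "s ^ i * n \<in> fspan F C N" if "n \<in> N" for n
        using N(3) A(7) s that by (auto intro: fspan.base)
      show "s ^ i * (c * b) \<in> fspan F C N" if "c \<in> F" "b \<in> B" for c b
        using fspan.scale[OF that(1) C[OF that(2) \<open>i < m\<close>]] by (simp add: mult_ac)
    qed
    then show ?thesis by (simp add: mult.commute)
  qed
  have top: "b * s ^ m \<in> fspan F C N" if b: "b \<in> B" for b
  proof -
    have "poly p s = (\<Sum>i<m. coeff p i * s ^ i) + s ^ m"
      using p(1,2) by (simp add: poly_altdef lessThan_Suc_atMost[symmetric])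
    then have "b * s ^ m = b * poly p s + (\<Sum>i<m. (- coeff p i) * (b * s ^ i))"
      by (simp add: algebra_simps sum_negf sum_distrib_left)
    moreover have "b * poly p s \<in> N" using b B(4) p(4) N(3) by blast
    moreover have "(\<Sum>i<m. (- coeff p i) * (b * s ^ i)) \<in> fspan F C N"
      using p(3) F(5) C[OF b] N(1) by (intro fspan_sum fspan.scale) auto
    ultimately show ?thesis using fspan.base fspan.add by metis
  qed
  have "t * c \<in> fspan F C N" if t: "t \<in> insert s S" and "c \<in> C" for t c
  proof -
    obtain b i where bi: "c = b * s ^ i" "b \<in> B" "i < m" using \<open>c \<in> C\<close> by (auto simp: C_def)
    show ?thesis
    proof (cases "t = s")
      case True
      have eq: "t * c = b * s ^ Suc i" using bi True by simp
      show ?thesis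
      proof (cases "Suc i = m")
        case True
        then show ?thesis using top[OF bi(2)] eq by simp
      next
        case False
        then have "Suc i < m" using bi by simp
        then show ?thesis using fspan.scale[OF F(2) C[OF bi(2)], of "Suc i" N] eq by simp
      qed
    next
      case False
      then have "(t * b) * s ^ i \<in> fspan F C N" using t B(3) bi * by blast
      then show ?thesis using bi by (simp add: mult.assoc)
    qed
  qed
  moreover have "1 \<in> C" using C[OF B(2), of 0] by (simp add: m_def)
  moreover have "finite C" using B(1) by (simp add: C_def)
  ultimately show ?case using CA by (auto simp: N_def)
qed

text \<open>The elements of A that multiply the span of B plus xA into itself form a subring
  containing F and the generators, hence all of A. Applying them to 1 puts A into the span.\<close>

lemma finite_dimensional_modulo:
  assumes x: "x \<in> A" "x \<notin> V"
  shows "\<exists>B. finite B \<and> A \<subseteq> fspan F B ((*) x ` A)"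
proof -
  define N where "N = (*) x ` A"
  note N = ideal_multiples[OF x(1), folded N_def]
  obtain S where S: "finite S" "S \<subseteq> A" "\<And>M. subring M \<Longrightarrow> F \<subseteq> M \<Longrightarrow> S \<subseteq> M \<Longrightarrow> A \<subseteq> M"
    using finitely_generated by blast
  obtain B where B: "finite B" "1 \<in> B" "\<And>s b. s \<in> S \<Longrightarrow> b \<in> B \<Longrightarrow> s * b \<in> fspan F B N" "B \<subseteq> A"
    using finite_span_stable[OF x S(1,2)] by (auto simp: N_def)
  have scal: "c * v \<in> fspan F B N" if c: "c \<in> F" "v \<in> fspan F B N" for c v
  proof (rule fspan_mult[OF c(2)])
    show "c * n \<in> fspan F B N" if "n \<in> N" for n
      using that c N(3) F_in_A by (blast intro: fspan.base)
    show "c * (d * b) \<in> fspan F B N" if "d \<in> F" "b \<in> B" for d b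
      using fspan.scale[OF F(4)[OF c(1) that(1)] that(2), of N] by (simp add: mult.assoc)
  qed
  define M where "M = {a \<in> A. \<forall>v\<in>fspan F B N. a * v \<in> fspan F B N}"
  have "subring M"
    unfolding subring_def
  proof (intro conjI ballI)
    show "0 \<in> M" "1 \<in> M" using A(1,2) N(1) by (auto simp: M_def intro: fspan.base)
    fix a b assume "a \<in> M" "b \<in> M"
    then show "a + b \<in> M" "a * b \<in> M"
      using A(3,4) by (auto simp: M_def distrib_right mult.assoc intro: fspan.add)
    have "(- 1) * (a * v) \<in> fspan F B N" if "v \<in> fspan F B N" for v
      using scal[OF F(5)[OF F(2)]] that \<open>a \<in> M\<close> by (auto simp: M_def)
    then show "- a \<in> M" using A(5) \<open>a \<in> M\<close> by (auto simp: M_def)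
  qed
  moreover have "F \<subseteq> M" using scal F_A by (auto simp: M_def)
  moreover have "S \<subseteq> M"
  proof
    fix s assume s: "s \<in> S"
    then have "s \<in> A" using S by blast
    have "s * v \<in> fspan F B N" if v: "v \<in> fspan F B N" for v
    proof (rule fspan_mult[OF v])
      show "s * n \<in> fspan F B N" if "n \<in> N" for n
        using that N(3) \<open>s \<in> A\<close> by (blast intro: fspan.base)
      show "s * (c * b) \<in> fspan F B N" if "c \<in> F" "b \<in> B" for c b
        using scal[OF that(1) B(3)[OF s that(2)]] by (simp add: mult.left_commute)
    qed
    with \<open>s \<in> A\<close> show "s \<in> M" by (simp add: M_def)
  qed
  ultimately have "A \<subseteq> M" using S(3) by blast
  moreover have "1 \<in> fspan F B N" using fspan.scale[OF F(2) B(2), of N] by simp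
  ultimately have "A \<subseteq> fspan F B N" by (force simp: M_def)
  then show ?thesis using B(1) by (auto simp: N_def)
qed

text \<open>The dimension of A/xA bounds the number of pole orders not attained on xA. Too many
  elements with distinct such orders would have a non-trivial combination in xA, and by
  \<open>same_sum\<close> its order is that of one of them.\<close>

lemma minimal_orders_finite:
  assumes x: "x \<in> A" "x \<notin> V"
  shows "\<exists>G. finite G \<and> G \<subseteq> A - {0} \<and>
    (\<forall>a\<in>A. a \<noteq> 0 \<longrightarrow> (\<forall>b\<in>A. \<not> same a (x * b)) \<longrightarrow> (\<exists>g\<in>G. same a g))"
proof (rule ccontr)
  define N where "N = (*) x ` A"
  note N = ideal_multiples[OF x(1), folded N_def]
  define L where "L = {a \<in> A. a \<noteq> 0 \<and> (\<forall>b\<in>A. \<not> same a (x * b))}"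
  assume contra: "\<not> ?thesis"
  have step: "\<exists>a\<in>L. \<forall>g\<in>G. \<not> same a g" if "finite G" "G \<subseteq> A - {0}" for G
  proof (rule ccontr)
    assume "\<not> ?thesis"
    then have "\<forall>a\<in>A. a \<noteq> 0 \<longrightarrow> (\<forall>b\<in>A. \<not> same a (x * b)) \<longrightarrow> (\<exists>g\<in>G. same a g)"
      unfolding L_def by blast
    with that contra show False by metis
  qed
  have ex: "\<exists>G. finite G \<and> card G = n \<and> G \<subseteq> L \<and> (\<forall>g\<in>G. \<forall>h\<in>G. g \<noteq> h \<longrightarrow> \<not> same g h)" for n
  proof (induction n)
    case 0
    show ?case by (rule exI[of _ "{}"]) simp
  next
    case (Suc n)
    then obtain G where G: "finite G" "card G = n" "G \<subseteq> L" "\<forall>g\<in>G. \<forall>h\<in>G. g \<noteq> h \<longrightarrow> \<not> same g h" by blast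
    then obtain a where a: "a \<in> L" "\<forall>g\<in>G. \<not> same a g" using step[of G] by (auto simp: L_def)
    then have "a \<notin> G" by auto
    then show ?case
      using G a same_sym by (intro exI[of _ "insert a G"]) auto
  qed
  obtain B where B: "finite B" "A \<subseteq> fspan F B N"
    using finite_dimensional_modulo[OF x] by (auto simp: N_def)
  obtain G where G: "finite G" "card G = Suc (card B)" "G \<subseteq> L"
    "\<And>g h. g \<in> G \<Longrightarrow> h \<in> G \<Longrightarrow> g \<noteq> h \<Longrightarrow> \<not> same g h" using ex[of "Suc (card B)"] by metis
  have "\<forall>g\<in>G. \<exists>c. (\<forall>b\<in>B. c b \<in> F) \<and> g - (\<Sum>b\<in>B. c b * b) \<in> N"
  proof
    fix g assume "g \<in> G"
    then have "g \<in> fspan F B N" using G B by (auto simp: L_def)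
    then show "\<exists>c. (\<forall>b\<in>B. c b \<in> F) \<and> g - (\<Sum>b\<in>B. c b * b) \<in> N"
      by (rule fspan_coefficients[OF _ B(1) subring_F N(1,2)])
  qed
  then obtain c where c: "\<And>g b. g \<in> G \<Longrightarrow> b \<in> B \<Longrightarrow> c g b \<in> F"
    "\<And>g. g \<in> G \<Longrightarrow> g - (\<Sum>b\<in>B. c g b * b) \<in> N"
    by (auto simp: bchoice_iff)
  have "\<exists>d. (\<forall>g\<in>G. d g \<in> F) \<and> (\<exists>g\<in>G. d g \<noteq> 0) \<and> (\<Sum>g\<in>G. d g * g) \<in> N"
    by (rule linear_dependence_modulo[OF B(1) G(1) _ subring_F inverse_F N(1,2) N(3)[OF F_in_A] c]) (use G in auto)
  then obtain d where d: "\<forall>g\<in>G. d g \<in> F" "\<exists>g\<in>G. d g \<noteq> 0" "(\<Sum>g\<in>G. d g * g) \<in> N" by blast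
  define H where "H = {g \<in> G. d g \<noteq> 0}"
  have "(\<Sum>g\<in>G. d g * g) = (\<Sum>g\<in>H. d g * g)"
    using G(1) by (intro sum.mono_neutral_right) (auto simp: H_def)
  moreover have same_dg: "same (d g * g) g" if "g \<in> H" for g
    using that d(1) F_scale_same by (auto simp: H_def)
  have "\<exists>g\<in>H. same (\<Sum>g\<in>H. d g * g) (d g * g)"
  proof (rule same_sum)
    show "finite H" "H \<noteq> {}" using G(1) d(2) by (auto simp: H_def)
    show "\<not> same (d g * g) (d h * h)" if "g \<in> H" "h \<in> H" "g \<noteq> h" for g h
      using that G(4)[of g h] same_dg[of g] same_dg[of h] same_sym same_trans by (metis (mono_tags, lifting) H_def mem_Collect_eq)
  qed
  ultimately obtain g where g: "g \<in> H" "same (\<Sum>g\<in>G. d g * g) g" using same_dg same_trans by metis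
  then obtain b where "b \<in> A" "same (x * b) g" using d(3) by (auto simp: N_def)
  moreover have "g \<in> L" using g G by (auto simp: H_def)
  ultimately show False using same_sym by (auto simp: L_def)
qed

text \<open>An element whose order is attained on xA has the order of x b, and b is smaller by one
  factor x. Repeating this stops because a is bounded by some power of x, and it ends at one of the
  finitely many orders not attained on xA.\<close>

lemma order_generators:
  obtains x G where "x \<in> A" "lt 1 x" "finite G" "G \<subseteq> A - {0}"
    "\<And>a. a \<in> A \<Longrightarrow> a \<noteq> 0 \<Longrightarrow> \<exists>g\<in>G. \<exists>j. same a (g * x ^ j)"
proof -
  obtain x where x: "x \<in> A" "x \<notin> V" using A_V by blast
  have lx: "lt 1 x" using x by (simp add: lt_def le_1)
  then have x0: "x \<noteq> 0" by (rule lt_nonzero)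
  obtain G where G: "finite G" "G \<subseteq> A - {0}"
    "\<And>a. a \<in> A \<Longrightarrow> a \<noteq> 0 \<Longrightarrow> (\<forall>b\<in>A. \<not> same a (x * b)) \<Longrightarrow> \<exists>g\<in>G. same a g"
    using minimal_orders_finite[OF x] by metis
  have "\<exists>g\<in>G. \<exists>j. same a (g * x ^ j)" if "a \<in> A" "a \<noteq> 0" "le a (x ^ n)" for a n
    using that
  proof (induction n arbitrary: a)
    case 0
    have "\<not> same a (x * b)" if b: "b \<in> A" for b
    proof
      assume s: "same a (x * b)"
      then have "b \<noteq> 0" using 0 same_zero[OF s] by auto
      then have "le (x * 1) (x * b)" using A_ge_1[OF b] by (intro le_mult) auto
      also have "le (x * b) 1" using s 0 le_trans by (auto simp: same_def)
      finally (le_trans) show False using lx by (simp add: lt_def)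
    qed
    then obtain g where "g \<in> G" "same a (g * x ^ 0)" using G(3)[OF 0(1,2)] by auto
    then show ?case by blast
  next
    case (Suc n)
    show ?case
    proof (cases "\<forall>b\<in>A. \<not> same a (x * b)")
      case True
      then obtain g where "g \<in> G" "same a (g * x ^ 0)" using G(3)[OF Suc.prems(1,2)] by auto
      then show ?thesis by blast
    next
      case False
      then obtain b where b: "b \<in> A" "same a (x * b)" by blast
      then have "b \<noteq> 0" using Suc.prems same_zero[OF b(2)] by auto
      have "le (x * b) (x * x ^ n)" using b Suc.prems le_trans by (auto simp: same_def)
      then have "le b (x ^ n)" using x0 by simp
      then obtain g j where gj: "g \<in> G" "same b (g * x ^ j)" using Suc.IH b \<open>b \<noteq> 0\<close> by blast
      have "same a (g * x ^ Suc j)"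
        using same_trans[OF b(2) same_mult[OF same_refl gj(2)]] by (simp add: mult_ac)
      then show ?thesis using gj by blast
    qed
  qed
  then show ?thesis using that[OF x(1) lx G(1,2)] archimedean[OF lx] by metis
qed

text \<open>Well-foundedness without integer orders: the measure counts the pairs (g, j) with
  \<open>g * x ^ j\<close> strictly below a. There are finitely many, since g has order at least
  that of 1, which bounds j. The pair representing a smaller b is counted for a but not for b. Only
  0 has no such pair and is treated apart.\<close>

lemma pole_order_induct [consumes 1]:
  assumes "a \<in> A" and step: "\<And>a. a \<in> A \<Longrightarrow> (\<And>b. b \<in> A \<Longrightarrow> lt b a \<Longrightarrow> P b) \<Longrightarrow> P a"
  shows "P a"
proof -
  obtain x G where x: "x \<in> A" "lt 1 x" and G: "finite G" "G \<subseteq> A - {0}"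
    "\<And>a. a \<in> A \<Longrightarrow> a \<noteq> 0 \<Longrightarrow> \<exists>g\<in>G. \<exists>j. same a (g * x ^ j)" using order_generators by metis
  define below where "below a = {(g, j). g \<in> G \<and> lt (g * x ^ j) a}" for a
  have fin: "finite (below a)" for a
  proof -
    obtain n where n: "le a (x ^ n)" using archimedean[OF x(2)] by blast
    have "below a \<subseteq> G \<times> {..<n}"
    proof (clarsimp simp: below_def)
      fix g j assume g: "g \<in> G" "lt (g * x ^ j) a"
      have "le (1 * x ^ j) (g * x ^ j)" using g G(2) A_ge_1 by (intro le_mult) auto
      then have "lt (x ^ j) (x ^ n)" using g n le_lt_trans lt_le_trans by fastforce
      then show "j < n" using powers_mono[OF x(2), of n j] by (metis lt_def not_less)
    qed
    then show ?thesis using G(1) finite_subset by blast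
  qed
  have smaller: "card (below b) < card (below a)" if ba: "b \<in> A" "b \<noteq> 0" "lt b a" for a b
  proof (rule psubset_card_mono[OF fin])
    obtain g j where gj: "g \<in> G" "same b (g * x ^ j)" using G(3)[OF ba(1,2)] by blast
    then have "(g, j) \<in> below a" "(g, j) \<notin> below b"
      using ba le_lt_trans by (auto simp: below_def same_def lt_def)
    moreover have "below b \<subseteq> below a" using ba lt_trans by (auto simp: below_def)
    ultimately show "below b \<subset> below a" by blast
  qed
  have P0: "P 0" using step[OF A(1)] lt_nonzero by blast
  show ?thesis
    using assms(1)
  proof (induction "card (below a)" arbitrary: a rule: less_induct)
    case less
    show ?case using step[OF less.prems] less.hyps smaller P0 by metis
  qed
qed

text \<open>Pigeonhole on the powers of b: each has the order of some \<open>g * x ^ j\<close> with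
  g in the finite set G, so two powers share the same g, and their quotient has the order of a power
  of x.\<close>

lemma commensurable_with:
  assumes x: "lt 1 x" "finite G" "0 \<notin> G" "\<And>a. a \<in> A \<Longrightarrow> a \<noteq> 0 \<Longrightarrow> \<exists>g\<in>G. \<exists>j. same a (g * x ^ j)"
    and b: "b \<in> A" "lt 1 b"
  shows "\<exists>p>0. \<exists>q>0. same (b ^ p) (x ^ q)"
proof -
  have b0: "b \<noteq> 0" and x0: "x \<noteq> 0" using b(2) x(1) lt_nonzero by blast+
  have "\<forall>i. \<exists>g j. g \<in> G \<and> same (b ^ i) (g * x ^ j)"
    using x(4) A(7)[OF b(1)] b0 by (metis power_not_zero)
  then obtain g j where gj: "\<And>i. g i \<in> G" "\<And>i. same (b ^ i) (g i * x ^ j i)" by metis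
  have "\<not> inj_on g {..card G}"
  proof
    assume "inj_on g {..card G}"
    then have "card {..card G} \<le> card G" using gj(1) x(2) by (intro card_inj_on_le[of g]) auto
    then show False by simp
  qed
  then obtain i k where ik: "i < k" "g i = g k" unfolding inj_on_def by (metis linorder_neqE_nat)
  have "lt (1 ^ (k - i) * b ^ i) (b ^ (k - i) * b ^ i)"
    using lt_power[OF b(2)] ik b0 by (subst lt_cancel) auto
  then have "lt (b ^ i) (b ^ k)" using ik by (simp flip: power_add)
  then have "lt (g i * x ^ j i) (g k * x ^ j k)"
    using gj(2)[of i] gj(2)[of k] le_lt_trans lt_le_trans unfolding same_def by blast
  moreover have "g k \<noteq> 0" using gj(1)[of k] x(3) by auto
  ultimately have "lt (x ^ j i) (x ^ j k)" using ik by simp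
  then have j: "j i < j k" using powers_mono[OF x(1), of "j k" "j i"] by (metis lt_def not_less)
  have "same (b ^ (k - i) * (g i * x ^ j i)) (b ^ (k - i) * b ^ i)"
    using same_mult[OF same_refl same_sym[OF gj(2)]] .
  moreover have "b ^ (k - i) * b ^ i = b ^ k" "g k * x ^ j k = x ^ (j k - j i) * (g i * x ^ j i)"
    using ik j by (simp_all flip: power_add)
  ultimately have "same (b ^ (k - i) * (g i * x ^ j i)) (x ^ (j k - j i) * (g i * x ^ j i))"
    using gj(2)[of k] same_trans by metis
  then have "same (b ^ (k - i)) (x ^ (j k - j i))"
    using \<open>g k \<noteq> 0\<close> ik x0 by (simp add: same_def)
  then show ?thesis using ik j by (metis zero_less_diff)
qed

lemma commensurable:
  assumes "a \<in> A" "lt 1 a" "b \<in> A" "lt 1 b"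
  shows "\<exists>p>0. \<exists>q>0. same (a ^ p) (b ^ q)"
proof -
  obtain x G where x: "lt 1 x" "finite G" "0 \<notin> G" "\<And>a. a \<in> A \<Longrightarrow> a \<noteq> 0 \<Longrightarrow> \<exists>g\<in>G. \<exists>j. same a (g * x ^ j)"
    using order_generators by (metis Diff_iff insertI1 subsetD)
  obtain p q where pq: "p > 0" "q > 0" "same (a ^ p) (x ^ q)" using commensurable_with[OF x assms(1,2)] by blast
  obtain r s where rs: "r > 0" "s > 0" "same (b ^ r) (x ^ s)" using commensurable_with[OF x assms(3,4)] by blast
  have "same ((a ^ p) ^ s) ((x ^ q) ^ s)" "same ((b ^ r) ^ q) ((x ^ s) ^ q)"
    using pq rs by (auto intro: same_power)
  then have "same (a ^ (p * s)) (b ^ (r * q))"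
    using pq(3) rs(3) same_power[of "a ^ p" "x ^ q" s] same_power[of "b ^ r" "x ^ s" q] same_sym same_trans
    by (metis mult.commute power_mult)
  then show ?thesis using pq rs by (metis nat_0_less_mult_iff)
qed

end

section \<open>Derivations and pole orders\<close>

text \<open>Only the values of D on A are constrained, so a vector field on C need not be extended
  to the function field.\<close>

locale one_place_derivation = one_place F A V for F A V :: "'f::field set" +
  fixes D :: "'f \<Rightarrow> 'f"
  assumes D_A: "a \<in> A \<Longrightarrow> D a \<in> A"
    and D_add: "a \<in> A \<Longrightarrow> b \<in> A \<Longrightarrow> D (a + b) = D a + D b"
    and D_mult: "a \<in> A \<Longrightarrow> b \<in> A \<Longrightarrow> D (a * b) = a * D b + b * D a"
    and D_F: "c \<in> F \<Longrightarrow> D c = 0"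
    and D_nontrivial: "\<exists>a\<in>A. D a \<noteq> 0"
begin

lemma D_scale: "c \<in> F \<Longrightarrow> a \<in> A \<Longrightarrow> D (c * a) = c * D a"
  by (simp add: D_mult F_in_A D_F)

lemma D_diff: "a \<in> A \<Longrightarrow> b \<in> A \<Longrightarrow> D (a - b) = D a - D b"
  using D_add[of "a - b" b] A(6)[of a b] by simp

lemma D_power: "a \<in> A \<Longrightarrow> D (a ^ Suc n) = of_nat (Suc n) * a ^ n * D a"
proof (induction n)
  case (Suc n)
  have "D (a ^ Suc (Suc n)) = a * D (a ^ Suc n) + a ^ Suc n * D a"
    using D_mult[OF Suc.prems A(7)[OF Suc.prems, of "Suc n"]] by simp
  then show ?case using Suc by (simp add: algebra_simps)
qed (simp add: D_mult)

lemma finite_le_maximum: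
  assumes "finite H" "H \<noteq> {}" shows "\<exists>h\<in>H. \<forall>k\<in>H. le (w k) (w h)"
  using assms
proof (induction rule: finite_ne_induct)
  case (insert k H)
  then obtain h where h: "h \<in> H" "\<forall>k\<in>H. le (w k) (w h)" by blast
  then show ?case using le_total[of "w k" "w h"] le_trans by (metis insert_iff le_refl)
qed simp

text \<open>The growth factor e of D is attained on one of the finitely many elements whose pole
  orders generate all others.\<close>
lemma growth_bound:
  "\<exists>e. (\<forall>a\<in>A. le (D a) (a * e)) \<and> (\<exists>a\<in>A. a \<noteq> 0 \<and> D a = a * e) \<and> e \<noteq> 0"
proof -
  obtain x G where x: "x \<in> A" "lt 1 x" and G: "finite G" "G \<subseteq> A - {0}"
    "\<And>a. a \<in> A \<Longrightarrow> a \<noteq> 0 \<Longrightarrow> \<exists>g\<in>G. \<exists>j. same a (g * x ^ j)" using order_generators by metis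
  have x0: "x \<noteq> 0" using x(2) by (rule lt_nonzero)
  \<comment> \<open>The maximum is taken over logarithmic derivatives \<open>D k / k\<close>.
    Including x bounds D on the powers of x as well, and so, by the product rule, on all the
    representatives \<open>g * x ^ j\<close>.\<close>
  obtain h where h: "h \<in> insert x G" "\<forall>k\<in>insert x G. le (D k / k) (D h / h)"
    using finite_le_maximum[of "insert x G" "\<lambda>k. D k / k"] G(1) by (metis finite_insert insert_not_empty)
  define e where "e = D h / h"
  have H: "k \<noteq> 0" "k \<in> A" if "k \<in> insert x G" for k using that x(1) x0 G(2) by auto
  have gen: "le (D k) (k * e)" if "k \<in> insert x G" for k
  proof -
    have "le (k * (D k / k)) (k * e)" using h(2) that unfolding e_def by (intro le_mult) auto
    then show ?thesis using H[OF that] by simp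
  qed
  have pow: "le (D (x ^ j)) (x ^ j * e)" for j
  proof (induction j)
    case 0
    show ?case using D_F[OF F(2)] by simp
  next
    case (Suc j)
    have "le (x * D (x ^ j)) (x * (x ^ j * e))" "le (x ^ j * D x) (x ^ j * (x * e))"
      using Suc gen by (intro le_mult le_refl; simp)+
    then have "le (x * D (x ^ j) + x ^ j * D x) (x ^ Suc j * e)"
      by (intro le_add) (simp_all add: mult_ac)
    then show ?case using D_mult[OF x(1) A(7)[OF x(1), of j]] by simp
  qed
  have bound: "le (D a) (a * e)" if "a \<in> A" for a
    using that
  proof (induction a rule: pole_order_induct)
    case (1 a)
    show ?case
    proof (cases "a = 0")
      case True
      then show ?thesis using D_F[OF F(1)] by simp
    next
      case False
      then obtain g j where g: "g \<in> G" "same a (g * x ^ j)" using G(3) 1 by blast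
      define m where "m = g * x ^ j"
      have gA: "g \<in> A" "g \<noteq> 0" using g G(2) by auto
      have mA: "m \<in> A" "m \<noteq> 0" using gA x0 A(4) A(7)[OF x(1)] by (auto simp: m_def)
      have "le (g * D (x ^ j)) (g * (x ^ j * e))" "le (x ^ j * D g) (x ^ j * (g * e))"
        using pow gen[of g] g by (intro le_mult le_refl; simp)+
      then have "le (g * D (x ^ j) + x ^ j * D g) (m * e)"
        by (intro le_add) (simp_all add: m_def mult_ac)
      then have Dm: "le (D m) (m * e)" using D_mult[OF gA(1) A(7)[OF x(1), of j]] by (simp add: m_def)
      have am: "same a m" using g by (simp add: m_def)
      \<comment> \<open>After removal of the leading term \<open>c * m\<close>, the remainder r has
        smaller order and falls under the induction hypothesis.\<close>
      then obtain c where c: "c \<in> F" "lt (a - c * m) m"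
        using leading_coefficient[OF _ mA(2)] by (auto simp: same_def)
      define r where "r = a - c * m"
      have rA: "r \<in> A" using 1 mA c F_in_A A(4,6) by (simp add: r_def)
      have ra: "lt r a" using c am lt_le_trans by (auto simp: r_def same_def)
      have "le (D r) (r * e)" using 1 rA ra by blast
      also have "le (r * e) (a * e)" using ra lt_imp_le by (intro le_mult) auto
      finally (le_trans) have "le (D r) (a * e)" .
      moreover have "le (c * D m) (D m)" using c F_scale by blast
      then have "le (c * D m) (m * e)" using Dm le_trans by blast
      then have "le (c * D m) (a * e)"
        using le_trans le_mult[of m a e e] am by (auto simp: same_def)
      ultimately have "le (c * D m + D r) (a * e)" by (intro le_add)
      moreover have "a = c * m + r" by (simp add: r_def)
      then have "D a = c * D m + D r"
        using D_add[OF A(4)[OF F_in_A mA(1)] rA] D_scale mA c by simp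
      ultimately show ?thesis by simp
    qed
  qed
  moreover have "e \<noteq> 0" using bound D_nontrivial by force
  moreover have "D h = h * e" using H[OF h(1)] by (simp add: e_def)
  ultimately show ?thesis using H[OF h(1)] by blast
qed

text \<open>One element a attains the bound with equality. If a non-constant b fell short of it,
  write a^p = c b^q + r with r smaller, by commensurability: both c D(b^q) and D r are too small,
  while D(a^p) = p a^p e has full order because p is non-zero in characteristic zero.\<close>

lemma growth_exact:
  "\<exists>e. e \<noteq> 0 \<and> (\<forall>a\<in>A. le (D a) (a * e)) \<and> (\<forall>a\<in>A. lt 1 a \<longrightarrow> same (D a) (a * e))"
proof -
  obtain e a where e: "\<And>a. a \<in> A \<Longrightarrow> le (D a) (a * e)" "e \<noteq> 0" and a: "a \<in> A" "a \<noteq> 0" "D a = a * e"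
    using growth_bound by blast
  have "a \<notin> F" using a e D_F by auto
  then have a1: "lt 1 a" using nonconst_iff a by simp
  have "same (D b) (b * e)" if b: "b \<in> A" "lt 1 b" for b
  proof (rule ccontr)
    assume "\<not> same (D b) (b * e)"
    then have small: "lt (D b) (b * e)" using e(1)[OF b(1)] by (simp add: same_def lt_def)
    have b0: "b \<noteq> 0" using lt_nonzero b by blast
    obtain p q where "p > 0" "q > 0" "same (a ^ p) (b ^ q)"
      using commensurable[OF a(1) a1 b] by blast
    then obtain p q where pq: "same (a ^ Suc p) (b ^ Suc q)" by (metis gr0_conv_Suc)
    then obtain c where c: "c \<in> F" "lt (a ^ Suc p - c * b ^ Suc q) (b ^ Suc q)"
      using leading_coefficient[of "a ^ Suc p" "b ^ Suc q"] b0 by (auto simp: same_def)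
    define r where "r = a ^ Suc p - c * b ^ Suc q"
    have bq: "b ^ Suc q \<in> A" and ap: "a ^ Suc p \<in> A" using A(7) a b by blast+
    have rA: "r \<in> A" using A(4,6) ap bq F_in_A c by (simp add: r_def)
    have "lt (b ^ q * D b) (b ^ q * (b * e))" using small b0 by simp
    moreover have "le ((c * of_nat (Suc q)) * (b ^ q * D b)) (b ^ q * D b)"
      using F_scale F(4) of_nat_F c by blast
    ultimately have "lt (c * D (b ^ Suc q)) (b ^ Suc q * e)"
      using le_lt_trans D_power[OF b(1), of q] by (simp add: mult_ac)
    moreover have "lt (D r) (b ^ Suc q * e)"
      using e(1)[OF rA] c(2) e(2) lt_cancel[OF e(2), of r "b ^ Suc q"] le_lt_trans unfolding r_def by blast
    ultimately have "lt (c * D (b ^ Suc q) + D r) (b ^ Suc q * e)" by (rule lt_add)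
    moreover have "a ^ Suc p = c * b ^ Suc q + r" by (simp add: r_def)
    then have "D (a ^ Suc p) = c * D (b ^ Suc q) + D r"
      using D_add[OF A(4)[OF F_in_A bq] rA] D_scale bq c by simp
    moreover have "D (a ^ Suc p) = of_nat (Suc p) * (a ^ Suc p * e)"
      using D_power[OF a(1), of p] a(3) by (simp add: mult_ac)
    moreover have "same (of_nat (Suc p) * (a ^ Suc p * e)) (a ^ Suc p * e)"
      using F_scale_same[OF of_nat_F char_0] by blast
    moreover have "same (a ^ Suc p * e) (b ^ Suc q * e)" using same_mult[OF pq same_refl] .
    ultimately show False using same_trans by (metis lt_def same_def)
  qed
  then show ?thesis using e by blast
qed

lemma of_nat_diff_nonzero: "p \<noteq> q \<Longrightarrow> (of_nat q - of_nat p :: 'f) \<noteq> 0"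
  using char_0[of "q - p"] char_0[of "p - q"] by (cases "p < q") (auto simp: of_nat_diff)

section \<open>Wronskians and the sign of the shift\<close>

context
  fixes e
  assumes e: "e \<noteq> 0" "\<And>a. a \<in> A \<Longrightarrow> le (D a) (a * e)" "\<And>a. a \<in> A \<Longrightarrow> lt 1 a \<Longrightarrow> same (D a) (a * e)"
begin

text \<open>If f and g have commensurable but different pole orders, the leading terms of
  f D g and g D f cannot cancel.\<close>
lemma wronskian_distinct_orders:
  assumes f: "f \<in> A" and g: "g \<in> A" and gf: "lt g f"
    and u: "u \<in> F" "u \<noteq> 0" "f * D g - g * D f = u"
  shows "lt e 1"
\<comment> \<open>If e has order at least that of 1, then f g e has a genuine pole, so every
  constant multiple of u is negligible against it.\<close>
proof (rule ccontr)
  assume "\<not> lt e 1"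
  then have e1: "le 1 e" by (simp add: lt_def)
  have "g \<noteq> 0" using u D_F[OF F(1)] by auto
  then have g1: "le 1 g" using A_ge_1 g by blast
  then have f1: "lt 1 f" using gf le_lt_trans by blast
  then have f0: "f \<noteq> 0" by (rule lt_nonzero)
  have "le (1 * 1) (g * e)" using g1 e1 by (rule le_mult)
  then have "lt (1 * 1) (f * (g * e))" using f1 \<open>g \<noteq> 0\<close> e(1) by (intro lt_mult) auto
  then have big: "lt 1 (f * (g * e))" by simp
  have ubig: "lt (c * u) (f * (g * e))" if "c \<in> F" for c
    using le_lt_trans[OF F_le_1 big] F(4) u(1) that by blast
  have Df: "same (D f) (f * e)" using e(3) f f1 by blast
  show False
  proof (cases "g \<in> F")
    case True
    then have "- 1 * u = g * D f" using u(3) D_F[OF True] by (simp add: minus_equation_iff)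
    then have "lt (g * D f) (f * (g * e))" using ubig[OF F(5)[OF F(2)]] by simp
    moreover have "same (g * D f) (g * (f * e))" using same_mult[OF same_refl Df] .
    ultimately show False by (simp add: lt_def same_def mult_ac)
  next
    case False
    then have g1: "lt 1 g" using nonconst_iff g by blast
    then have Dg: "same (D g) (g * e)" using e(3) g by blast
    obtain q p where q0: "q > 0" "p > 0" "same (f ^ q) (g ^ p)" using commensurable[OF f f1 g g1] by blast
    have "q \<noteq> p" using lt_power[OF gf, of p] q0 by (auto simp: lt_def same_def)
    obtain q' p' where q': "q = Suc q'" "p = Suc p'" using q0 by (metis gr0_conv_Suc)
    obtain c where c: "c \<in> F" "lt (f ^ q - c * g ^ p) (g ^ p)"
      using leading_coefficient[of "f ^ q" "g ^ p"] q0 \<open>g \<noteq> 0\<close> by (auto simp: same_def)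
    define r where "r = f ^ q - c * g ^ p"
    have fq: "f ^ q \<in> A" and gp: "g ^ p \<in> A" using A(7) f g by blast+
    have rA: "r \<in> A" using A(4,6) fq gp F_in_A c by (simp add: r_def)
    have rf: "lt r (f ^ q)" using c q0 lt_le_trans by (auto simp: r_def same_def)
    have Dr: "D r = of_nat q * f ^ q' * D f - c * (of_nat p * g ^ p' * D g)"
      using D_diff[OF fq A(4)[OF F_in_A gp]] D_scale gp c D_power[OF f, of q'] D_power[OF g, of p']
      by (simp add: r_def q')
    \<comment> \<open>X is what differentiating f^q = c g^p + r leaves after elimination of c; since
      r is small, X is smaller than f g e. Adding q u turns X into (q - p) f D g, which has the full
      order of f g e because q and p differ. That is the contradiction.\<close>
    define X where "X = of_nat q * D f * g - of_nat p * f * D g"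
    have X: "f ^ q' * X = D r * g - of_nat p * (r * D g)"
      unfolding Dr X_def by (simp add: r_def q' algebra_simps)
    have "lt (D r * g) (f ^ q * (g * e))"
    proof -
      have "le (D r) (r * e)" using e(2) rA by blast
      moreover have "lt (r * e) (f ^ q * e)" using rf e(1) by simp
      ultimately have "lt (D r) (f ^ q * e)" by (rule le_lt_trans)
      then have "lt (D r * g) (f ^ q * e * g)" using \<open>g \<noteq> 0\<close> by simp
      then show ?thesis by (simp add: mult_ac)
    qed
    moreover have "lt (of_nat p * (r * D g)) (f ^ q * (g * e))"
    proof -
      have "lt (r * D g) (f ^ q * (g * e))"
        using rf Dg \<open>g \<noteq> 0\<close> e(1) by (intro lt_mult) (auto simp: same_def)
      then show ?thesis using F_scale[OF of_nat_F] le_lt_trans by blast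
    qed
    ultimately have "lt (f ^ q' * X) (f ^ q' * (f * (g * e)))"
      unfolding X using lt_diff by (simp add: q' mult_ac)
    then have "lt X (f * (g * e))" using f0 by simp
    then have "lt (X + of_nat q * u) (f * (g * e))" using ubig[OF of_nat_F] lt_add by blast
    moreover have "X + of_nat q * u = (of_nat q - of_nat p) * (f * D g)"
      unfolding X_def u(3)[symmetric] by (simp add: algebra_simps)
    moreover have "same ((of_nat q - of_nat p) * (f * D g)) (f * D g)"
      using F_scale_same[OF F(6)[OF of_nat_F of_nat_F] of_nat_diff_nonzero] \<open>q \<noteq> p\<close> by metis
    moreover have "same (f * D g) (f * (g * e))" using same_mult[OF same_refl Dg] .
    ultimately show False using same_trans by (metis lt_def same_def)
  qed
qed

text \<open>Replacing g by \<open>g - c * f\<close>, with c the leading coefficient of g relative to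
  f, keeps the Wronskian and makes the orders distinct. Exchanging f and g only changes its
  sign.\<close>

lemma wronskian_constant:
  assumes f: "f \<in> A" and g: "g \<in> A" and u: "u \<in> F" "u \<noteq> 0" "f * D g - g * D f = u"
  shows "lt e 1"
proof -
  have main: "lt e 1"
    if f: "f \<in> A" and g: "g \<in> A" and u: "u \<in> F" "u \<noteq> 0" "f * D g - g * D f = u" and "le g f" for f g u
  proof -
    have "f \<noteq> 0" using \<open>le g f\<close> u by auto
    then obtain c where c: "c \<in> F" "lt (g - c * f) f" using leading_coefficient \<open>le g f\<close> by blast
    have cf: "c * f \<in> A" using A(4) F_in_A c f by blast
    have "f * D (g - c * f) - (g - c * f) * D f = u"
      using u(3) by (simp add: D_diff[OF g cf] D_scale c f algebra_simps)
    then show ?thesis using wronskian_distinct_orders[OF f A(6)[OF g cf] c(2) u(1,2)] by blast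
  qed
  show ?thesis
  proof (cases "le g f")
    case True
    then show ?thesis using main[OF f g u] by blast
  next
    case False
    then have "le f g" using le_total by blast
    moreover have "g * D f - f * D g = - u" using u(3) by (simp add: algebra_simps)
    ultimately show ?thesis using main[OF g f F(5)[OF u(1)]] u(2) by simp
  qed
qed

text \<open>If D lowers pole orders, an element of minimal positive pole order has constant derivative,
  so D can be integrated within the polynomials in that element.\<close>
lemma polynomial_ring_if_decreasing:
  assumes "lt e 1"
  shows "\<exists>t\<in>A. A \<subseteq> fspan F (range ((^) t)) {0}"
proof -
  have lower: "lt (D a) a" if "a \<in> A" "a \<noteq> 0" for a
  proof -
    have "lt (a * e) (a * 1)" using that assms by (subst lt_cancel_left) auto
    then show ?thesis using e(2)[OF that(1)] le_lt_trans by simp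
  qed
  have "\<exists>t\<in>A. lt 1 t \<and> (\<forall>b\<in>A. lt b t \<longrightarrow> b \<in> F)" if "a \<in> A" "lt 1 a" for a
    using that
  proof (induction a rule: pole_order_induct)
    case (1 a)
    then show ?case using nonconst_iff by blast
  qed
  moreover obtain a where "a \<in> A" "lt 1 a" using A_V by (auto simp: lt_def le_1)
  ultimately obtain t where t: "t \<in> A" "lt 1 t" "\<And>b. b \<in> A \<Longrightarrow> lt b t \<Longrightarrow> b \<in> F" by blast
  have t0: "t \<noteq> 0" using t(2) by (rule lt_nonzero)
  define P where "P = fspan F (range ((^) t)) {0}"
  have P0: "0 \<in> P" unfolding P_def by (rule fspan.base) simp
  have Ps: "c * t ^ i \<in> P" if "c \<in> F" for c i unfolding P_def using that by (intro fspan.scale) auto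
  \<comment> \<open>D t lies below t, so it is constant by minimality of t; it is non-zero because D
    has exact growth on the non-constant t.\<close>
  define d where "d = D t"
  have dF: "d \<in> F" using t D_A lower t0 by (simp add: d_def)
  have d0: "d \<noteq> 0" using e(3)[OF t(1,2)] e(1) t0 same_zero by (auto simp: d_def)
  have anti: "\<exists>w\<in>P. w \<in> A \<and> D w = v" if "v \<in> P" for v
    using that unfolding P_def
  proof induction
    case (base v)
    then show ?case using P0 A(1) D_F[OF F(1)] by (auto simp: P_def)
  next
    case (scale c b)
    then obtain i where b: "b = t ^ i" by blast
    \<comment> \<open>Power rule backwards: c t^i has the antiderivative c t^(i+1) / ((i+1) d),
      where characteristic zero permits the division.\<close>
    define k where "k = c * inverse (of_nat (Suc i) * d)"
    have k: "k \<in> F" using scale F(4) inverse_F of_nat_F dF by (simp add: k_def del: of_nat_Suc)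
    have "D (k * t ^ Suc i) = k * (of_nat (Suc i) * t ^ i * d)"
      using D_scale[OF k A(7)[OF t(1)], of "Suc i"] D_power[OF t(1), of i] by (simp add: d_def)
    also have "\<dots> = c * t ^ i"
      using char_0[of "Suc i"] d0 by (simp add: k_def field_simps del: of_nat_Suc)
    finally have "D (k * t ^ Suc i) = c * b" by (simp add: b)
    moreover have "k * t ^ Suc i \<in> A" using A(4) A(7)[OF t(1)] F_in_A k by blast
    ultimately show ?case using Ps[OF k, of "Suc i"] unfolding P_def by blast
  next
    case (add v w)
    then show ?case using D_add A(3) fspan.add by metis
  qed
  have "a \<in> P" if "a \<in> A" for a
    using that
  proof (induction a rule: pole_order_induct)
    case (1 a)
    show ?case
    proof (cases "a \<in> F")
      case True
      then show ?thesis using Ps[OF True, of 0] by simp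
    next
      case False
      then have "a \<noteq> 0" using F(1) by auto
      then have "D a \<in> P" using 1 lower D_A by blast
      then obtain w where w: "w \<in> P" "w \<in> A" "D w = D a" using anti by blast
      have aw: "a - w \<in> A" "D (a - w) = 0" using A(6) D_diff 1 w by auto
      \<comment> \<open>The kernel of D is F: on a non-constant element the exact growth makes the
        derivative non-zero.\<close>
      have "a - w \<in> F"
      proof (rule ccontr)
        assume "a - w \<notin> F"
        then have l: "lt 1 (a - w)" using nonconst_iff aw by blast
        then have "same 0 ((a - w) * e)" using e(3)[OF aw(1)] aw(2) by simp
        then show False using same_zero[of 0 "(a - w) * e"] lt_nonzero[OF l] e(1) by simp
      qed
      from Ps[OF this, of 0] w have "w + (a - w) * t ^ 0 \<in> P" unfolding P_def by (intro fspan.add)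
      then show ?thesis by simp
    qed
  qed
  then show ?thesis using t(1) unfolding P_def by blast
qed

end

theorem polynomial_ring_if_constant_wronskian:
  assumes "f \<in> A" "g \<in> A" "u \<in> F" "u \<noteq> 0" "f * D g - g * D f = u"
  shows "\<exists>t\<in>A. A \<subseteq> fspan F (range ((^) t)) {0}"
  using growth_exact wronskian_constant[OF _ _ _ assms] polynomial_ring_if_decreasing by metis

end

section \<open>Affine curves with one place at infinity\<close>

lemma emb_simps [simp]:
  "emb 0 = 0" "emb 1 = 1" "emb (x + y) = emb x + emb y" "emb (x * y) = emb x * emb y"
  "emb (- x) = - emb x" "emb (x - y) = emb x - emb y" "emb x = emb y \<longleftrightarrow> x = y"
  by (simp_all add: emb_def Zero_fract_def One_fract_def eq_fract)

lemma emb_eq_0 [simp]: "emb x = 0 \<longleftrightarrow> x = 0"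
  using emb_simps(7)[of x 0] by simp

lemma subring_range_emb: "subring (range emb)"
  unfolding subring_def
proof (intro conjI ballI)
  show "0 \<in> range emb" "1 \<in> range emb" using emb_simps(1,2) by (metis rangeI)+
  fix x y :: "'a fract" assume "x \<in> range emb" "y \<in> range emb"
  then obtain a b where "x = emb a" "y = emb b" by blast
  then show "x + y \<in> range emb" "x * y \<in> range emb" "- x \<in> range emb"
    by (simp_all flip: emb_simps(3,4,5))
qed

locale one_place_curve =
  fixes \<iota> :: "'k::field_char_0 \<Rightarrow> 'a::idom"
  assumes alg_closed: "alg_closed TYPE('k)"
    and map: "k_algebra_map \<iota>"
    and fin_gen: "fin_gen_algebra \<iota>"
    and unique_place: "unique_place_at_infinity \<iota>"
begin

lemma \<iota>_simps [simp]:
  "\<iota> 0 = 0" "\<iota> 1 = 1" "\<iota> (a + b) = \<iota> a + \<iota> b" "\<iota> (a * b) = \<iota> a * \<iota> b"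
  "\<iota> (- a) = - \<iota> a" "\<iota> (a - b) = \<iota> a - \<iota> b"
proof -
  show 1: "\<iota> 1 = 1" "\<iota> (a + b) = \<iota> a + \<iota> b" "\<iota> (a * b) = \<iota> a * \<iota> b" for a b
    using map by (auto simp: k_algebra_map_def)
  have "\<iota> 0 = \<iota> 0 + \<iota> 0" using 1(2)[of 0 0] by (simp only: add_0_left)
  then show 0: "\<iota> 0 = 0" by (simp only: add_cancel_right_right)
  show "\<iota> (- a) = - \<iota> a" using 1(2)[of a "- a"] 0 by (simp add: eq_neg_iff_add_eq_0 add.commute)
  show "\<iota> (a - b) = \<iota> a - \<iota> b" using 1(2)[of "a - b" b] by (simp add: eq_diff_eq)
qed

lemma \<iota>_inverse: "c \<noteq> 0 \<Longrightarrow> \<iota> c * \<iota> (inverse c) = 1"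
  using \<iota>_simps(4)[of c "inverse c"] by (simp del: \<iota>_simps(4))

lemma \<iota>_eq_0 [simp]: "\<iota> c = 0 \<longleftrightarrow> c = 0"
  using \<iota>_inverse[of c] by (cases "c = 0") auto

lemma \<iota>_eq [simp]: "\<iota> a = \<iota> b \<longleftrightarrow> a = b"
  using \<iota>_eq_0[of "a - b"] by (simp del: \<iota>_eq_0)

definition const :: "'k \<Rightarrow> 'a fract" where "const c = emb (\<iota> c)"

lemma const_simps [simp]:
  "const 0 = 0" "const 1 = 1" "const (a + b) = const a + const b" "const (a * b) = const a * const b"
  "const (- a) = - const a" "const a = const b \<longleftrightarrow> a = b"
  by (simp_all add: const_def)

lemma const_inverse: "inverse (const c) = const (inverse c)"
proof (cases "c = 0")
  case False
  then have "const c * const (inverse c) = 1" by (simp flip: const_simps(4))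
  then show ?thesis by (rule inverse_unique)
qed simp

lemma const_of_nat: "of_nat n = const (of_nat n)"
  by (induction n) simp_all

lemma subring_const: "subring (range const)"
  unfolding subring_def
proof (intro conjI ballI)
  show "0 \<in> range const" "1 \<in> range const" using const_simps(1,2) by (metis rangeI)+
  fix x y assume "x \<in> range const" "y \<in> range const"
  then obtain a b where "x = const a" "y = const b" by blast
  then show "x + y \<in> range const" "x * y \<in> range const" "- x \<in> range const"
    by (simp_all flip: const_simps(3,4,5))
qed

lemma poly_const: "poly (map_poly const q) (const c) = const (poly q c)"
  by (induction q) (simp_all add: map_poly_pCons)

lemma const_root:
  assumes "p \<in> polys_over (range const)" "degree p > 0"
  shows "\<exists>c\<in>range const. poly p c = 0"
proof -
  define q where "q = map_poly (inv const) p"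
  have inj: "inj const" by (simp add: inj_def)
  have "inv const 0 = 0" using inv_f_f[OF inj, of 0] by simp
  then have "map_poly const q = p"
    using assms(1) by (intro poly_eqI) (simp add: q_def coeff_map_poly polys_over_def f_inv_into_f)
  moreover then have "degree q \<ge> 1" using assms(2) map_poly_degree_leq[of const q] by simp
  then obtain c where "poly q c = 0" using alg_closed by (auto simp: alg_closed_def)
  ultimately show ?thesis using poly_const[of q c] by auto
qed

definition V :: "'a fract set" where "V = (THE V. place_at_infinity \<iota> V)"

lemma V: "place_at_infinity \<iota> V" and V_unique: "place_at_infinity \<iota> W \<Longrightarrow> W = V"
  using unique_place unfolding unique_place_at_infinity_def V_def
  by (metis theI')+

lemma place_iff:
  "place \<iota> W \<longleftrightarrow> valuation_ring W \<and> range const \<subseteq> W \<and> W \<noteq> UNIV"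
  unfolding place_def valuation_ring_def subring_def const_def
  by (auto simp: image_subset_iff) (metis inverse_zero)

sublocale K: one_place "range const" "range emb" V
proof
  show "subring (range const)" by (rule subring_const)
  show "inverse x \<in> range const" if "x \<in> range const" for x using that const_inverse by auto
  show "\<exists>c\<in>range const. poly p c = 0" if "p \<in> polys_over (range const)" "degree p > 0" for p
    using that by (rule const_root)
  show "of_nat n \<noteq> (0 :: 'a fract)" if "n > 0" for n
    using that const_simps(6)[of "of_nat n" 0] by (simp add: const_of_nat del: const_simps(6))
  show "subring (range emb)" by (rule subring_range_emb)
  show "range const \<subseteq> range emb" by (auto simp: const_def)
  show "\<exists>a\<in>range emb. \<exists>b\<in>range emb. b \<noteq> 0 \<and> z = a / b" for z :: "'a fract"
  proof (cases z)
    case (Fract a b)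
    then have "z = emb a / emb b" by (simp add: emb_def)
    then show ?thesis using Fract by (metis emb_eq_0 rangeI)
  qed
  show "\<exists>S. finite S \<and> S \<subseteq> range emb \<and>
    (\<forall>M. subring M \<longrightarrow> range const \<subseteq> M \<longrightarrow> S \<subseteq> M \<longrightarrow> range emb \<subseteq> M)"
  proof -
    obtain S where S: "finite S" "subalg_gen \<iota> S = UNIV" using fin_gen by (auto simp: fin_gen_algebra_def)
    have "emb x \<in> M" if "subring M" "range const \<subseteq> M" "emb ` S \<subseteq> M" "x \<in> subalg_gen \<iota> S" for M x
      using that(4)
    proof induction
      case (scal c)
      then show ?case using that(2) by (auto simp: const_def)
    next
      case (gen s)
      then show ?case using that(3) by auto
    qed (use subringD(3,4)[OF that(1)] in auto)
    then show ?thesis using S by (intro exI[of _ "emb ` S"]) auto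
  qed
  show "valuation_ring V" "range const \<subseteq> V" "\<not> range emb \<subseteq> V"
    using V by (auto simp: place_at_infinity_def place_iff)
  show "W = V" if "valuation_ring W" "range const \<subseteq> W" "\<not> range emb \<subseteq> W" for W
    using that by (intro V_unique) (auto simp: place_at_infinity_def place_iff)
qed

text \<open>A unit or its inverse has no pole at infinity; being regular on C as well, that one is
  constant, and hence so is the other.\<close>

lemma unit_const:
  assumes "u dvd 1" shows "\<exists>c. c \<noteq> 0 \<and> u = \<iota> c"
proof -
  obtain v where uv: "u * v = 1" using assms by (metis dvdE)
  then have inv: "inverse (emb u) = emb v" by (intro inverse_unique) (simp flip: emb_simps(4))
  have "emb u \<in> V \<or> emb v \<in> V" using K.V inv by (auto simp: valuation_ring_def)
  then have "emb u \<in> range const \<or> emb v \<in> range const" using K.A_Int_V by blast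
  then have "emb u \<in> range const" using K.inverse_F[of "emb v"] inverse_inverse_eq[of "emb u"] inv by auto
  then obtain c where "u = \<iota> c" by (auto simp: const_def)
  then show ?thesis using uv by auto
qed

lemma k_derivationD:
  assumes "D \<in> Vec \<iota>"
  shows "D (x + y) = D x + D y" "D (x * y) = x * D y + y * D x" "D (\<iota> c) = 0" "D 1 = 0"
    "D (- x) = - D x" "D 0 = 0"
proof -
  have *: "D (x + y) = D x + D y" "D (x * y) = x * D y + y * D x" "D (\<iota> c * x) = \<iota> c * D x" for x y c
    using assms by (auto simp: Vec_def k_derivation_def)
  show "D (x + y) = D x + D y" "D (x * y) = x * D y + y * D x" by (rule *)+
  have "D 1 = D 1 + D 1" using *(2)[of 1 1] by (simp only: mult_1_left)
  then show 1: "D 1 = 0" by (simp only: add_cancel_right_right)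
  show "D (\<iota> c) = 0" using *(3)[of c 1] 1 by simp
  have "D 0 = D 0 + D 0" using *(1)[of 0 0] by (simp only: add_0_left)
  then show 0: "D 0 = 0" by (simp only: add_cancel_right_right)
  show "D (- x) = - D x" using *(1)[of x "- x"] 0 by (simp add: eq_neg_iff_add_eq_0 add.commute)
qed

lemma Vec_mult: "D \<in> Vec \<iota> \<Longrightarrow> (\<lambda>x. f * D x) \<in> Vec \<iota>"
  by (auto simp: Vec_def k_derivation_def algebra_simps)

text \<open>Inside the function field O(C) consists of polynomials in a single t, so its fractions
  all lie in k(t).\<close>

lemma rational_if_constant_wronskian:
  assumes D: "D \<in> Vec \<iota>" and nz: "D x \<noteq> 0" and u: "f * D g - g * D f = \<iota> u" "u \<noteq> 0"
  shows "rational_curve \<iota>"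
proof -
  \<comment> \<open>E carries D over to the image of O(C) in the function field; its values
    elsewhere are arbitrary.\<close>
  define E where "E y = emb (D (inv emb y))" for y
  have inj: "inj (emb :: 'a \<Rightarrow> _)" by (simp add: inj_def)
  have E: "E (emb a) = emb (D a)" for a by (simp add: E_def inv_f_f[OF inj])
  note Dd = k_derivationD[OF D]
  interpret E: one_place_derivation "range const" "range emb" V E
  proof
    show "E a \<in> range emb" for a by (simp add: E_def)
    show "E (a + b) = E a + E b" "E (a * b) = a * E b + b * E a"
      if "a \<in> range emb" "b \<in> range emb" for a b
      using that by (auto simp: E Dd simp flip: emb_simps(3,4))
    show "E c = 0" if "c \<in> range const" for c using that by (auto simp: const_def E Dd)
    show "\<exists>a\<in>range emb. E a \<noteq> 0" using nz by (auto simp: E intro!: exI[of _ x])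
  qed
  have "emb f * E (emb g) - emb g * E (emb f) = const u"
    using u(1) by (simp add: E const_def flip: emb_simps(4,6))
  then obtain t where t: "range emb \<subseteq> fspan (range const) (range ((^) t)) {0}"
    using E.polynomial_ring_if_constant_wronskian[of "emb f" "emb g" "const u"] u(2) const_simps(6)[of u 0]
    by auto
  define L where "L = subfield_gen \<iota> {t}"
  have zero: "0 \<in> L" and one: "1 \<in> L"
    using subfield_gen.scal[of \<iota> 0 "{t}"] subfield_gen.scal[of \<iota> 1 "{t}"] by (simp_all add: L_def)
  have "t ^ i \<in> L" for i
    by (induction i) (use one in \<open>auto simp: L_def intro: subfield_gen.mult subfield_gen.gen\<close>)
  note pow = this
  have "y \<in> L" if "y \<in> fspan (range const) (range ((^) t)) {0}" for y
    using that
  proof induction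
    case (scale c b)
    then show ?case using pow by (auto simp: L_def const_def intro: subfield_gen.mult subfield_gen.scal)
  qed (use zero in \<open>auto simp: L_def intro: subfield_gen.add\<close>)
  then have "range emb \<subseteq> L" using t by blast
  moreover have "\<exists>a\<in>range emb. \<exists>b\<in>range emb. z = a * inverse b" for z :: "'a fract"
    using K.fractions[of z] by (auto simp: divide_inverse)
  ultimately have "z \<in> L" for z
    unfolding L_def by (metis subfield_gen.inv subfield_gen.mult subsetD)
  then show ?thesis by (auto simp: rational_curve_def L_def)
qed

end

section \<open>Maximal ideals\<close>

lemma maximal_ideal_bezout:
  fixes M :: "'a::comm_ring_1 set"
  assumes "maximal_ideal M" "x \<notin> M" shows "\<exists>m\<in>M. \<exists>r. 1 = m + r * x"
proof -
  have M: "is_ideal M" "\<And>J. is_ideal J \<Longrightarrow> M \<subseteq> J \<Longrightarrow> J = M \<or> 1 \<in> J"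
    using assms(1) by (auto simp: maximal_ideal_def)
  have Mi: "0 \<in> M" "\<And>x y. x \<in> M \<Longrightarrow> y \<in> M \<Longrightarrow> x + y \<in> M" "\<And>x r. x \<in> M \<Longrightarrow> r * x \<in> M"
    using M(1) by (auto simp: is_ideal_def)
  define J where "J = {m + r * x |m r. m \<in> M}"
  have "is_ideal J"
    unfolding is_ideal_def
  proof (intro conjI ballI allI)
    have "0 = 0 + 0 * x" by simp
    then show "0 \<in> J" using Mi(1) unfolding J_def by blast
    fix a assume "a \<in> J"
    then obtain m r where a: "a = m + r * x" "m \<in> M" by (auto simp: J_def)
    show "a + b \<in> J" if b: "b \<in> J" for b
    proof -
      obtain m' r' where b: "b = m' + r' * x" "m' \<in> M" using b by (auto simp: J_def)
      have "a + b = (m + m') + (r + r') * x" using a b by (simp add: algebra_simps)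
      then show ?thesis using a b Mi(2) unfolding J_def by blast
    qed
    show "s * a \<in> J" for s
    proof -
      have "s * a = s * m + (s * r) * x" using a by (simp add: algebra_simps)
      then show ?thesis using a Mi(3) unfolding J_def by blast
    qed
  qed
  moreover have "M \<subseteq> J"
  proof
    fix m assume "m \<in> M"
    moreover have "m = m + 0 * x" by simp
    ultimately show "m \<in> J" unfolding J_def by blast
  qed
  moreover have "0 + 1 * x \<in> J" using Mi(1) unfolding J_def by blast
  ultimately have "1 \<in> J" using M(2)[of J] assms(2) by auto
  then show ?thesis by (auto simp: J_def)
qed

lemma maximal_ideal_prime:
  fixes M :: "'a::comm_ring_1 set"
  assumes M: "maximal_ideal M" and xy: "x * y \<in> M" shows "x \<in> M \<or> y \<in> M"
proof (rule ccontr)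
  assume *: "\<not> (x \<in> M \<or> y \<in> M)"
  then obtain m r where m: "m \<in> M" "1 = m + r * x" using maximal_ideal_bezout[OF M] by blast
  have "y = y * 1" by simp
  also have "\<dots> = y * m + r * (x * y)" unfolding m(2) by (simp add: algebra_simps)
  finally have "y = y * m + r * (x * y)" .
  moreover have "y * m + r * (x * y) \<in> M" using M m(1) xy by (simp add: maximal_ideal_def is_ideal_def)
  ultimately show False using * by simp
qed

lemma maximal_ideal_exists:
  fixes I :: "'a::comm_ring_1 set"
  assumes I: "is_ideal I" "1 \<notin> I"
  shows "\<exists>M. maximal_ideal M \<and> I \<subseteq> M"
proof -
  define \<A> where "\<A> = {J. is_ideal J \<and> 1 \<notin> J \<and> I \<subseteq> J}"
  have "\<exists>M\<in>\<A>. \<forall>X\<in>\<A>. M \<subseteq> X \<longrightarrow> X = M"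
  proof (rule subset_Zorn_nonempty)
    show "\<A> \<noteq> {}" using I by (auto simp: \<A>_def)
    fix C assume C: "C \<noteq> {}" "subset.chain \<A> C"
    then have g: "is_ideal X" "1 \<notin> X" "I \<subseteq> X" if "X \<in> C" for X
      using that by (auto simp: subset_chain_def \<A>_def)
    have "is_ideal (\<Union>C)"
      unfolding is_ideal_def
    proof (intro conjI ballI allI)
      show "0 \<in> \<Union>C" using C(1) g by (auto simp: is_ideal_def)
      fix x assume "x \<in> \<Union>C"
      then obtain X where X: "X \<in> C" "x \<in> X" by blast
      show "r * x \<in> \<Union>C" for r using X g(1)[OF X(1)] unfolding is_ideal_def by blast
      show "x + y \<in> \<Union>C" if y: "y \<in> \<Union>C" for y
      proof -
        obtain Y where Y: "Y \<in> C" "y \<in> Y" using y by blast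
        have "X \<subseteq> Y \<or> Y \<subseteq> X" using C(2) X Y by (auto simp: subset_chain_def)
        then show ?thesis using X Y g(1)[OF X(1)] g(1)[OF Y(1)] unfolding is_ideal_def by blast
      qed
    qed
    moreover have "1 \<notin> \<Union>C" "I \<subseteq> \<Union>C" using C(1) g by blast+
    ultimately show "\<Union>C \<in> \<A>" by (simp add: \<A>_def)
  qed
  then obtain M where M: "M \<in> \<A>" "\<And>X. X \<in> \<A> \<Longrightarrow> M \<subseteq> X \<Longrightarrow> X = M" by blast
  have "J = M \<or> 1 \<in> J" if "is_ideal J" "M \<subseteq> J" for J
    using M(1) M(2)[of J] that by (auto simp: \<A>_def)
  then show ?thesis using M(1) by (auto simp: \<A>_def maximal_ideal_def)
qed

text \<open>Nakayama's lemma for a localisation, by eliminating the generators one at a time.\<close>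
lemma nakayama_elimination:
  fixes M :: "'a::comm_ring_1 set"
  assumes M: "maximal_ideal M" and "finite T"
    and rel: "\<And>m. m \<in> T \<Longrightarrow> \<exists>s r q. s \<notin> M \<and> (\<forall>n\<in>T. q n \<in> M) \<and> s * m = r * t + (\<Sum>n\<in>T. q n * n)"
  shows "\<exists>s. s \<notin> M \<and> (\<forall>m\<in>T. t dvd s * m)"
  using assms(2,3)
proof (induction T rule: finite_induct)
  case empty
  then show ?case using M by (auto simp: maximal_ideal_def)
next
  case (insert m0 T)
  have Mi: "0 \<in> M" "\<And>x y. x \<in> M \<Longrightarrow> y \<in> M \<Longrightarrow> x + y \<in> M" "\<And>x r. x \<in> M \<Longrightarrow> r * x \<in> M"
    using M by (auto simp: maximal_ideal_def is_ideal_def)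
  obtain s r q where s: "s \<notin> M" "\<forall>n\<in>insert m0 T. q n \<in> M"
    "s * m0 = r * t + (\<Sum>n\<in>insert m0 T. q n * n)" using insert.prems[of m0] by blast
  \<comment> \<open>Moving the term of m0 itself to the left leaves the coefficient s - q(m0), which
    is outside M since q(m0) lies in M.\<close>
  define s1 where "s1 = s - q m0"
  have s1: "s1 \<notin> M"
  proof
    assume "s1 \<in> M"
    then have "s1 + q m0 \<in> M" using s Mi(2) by blast
    then show False using s by (simp add: s1_def)
  qed
  have m0: "s1 * m0 = r * t + (\<Sum>n\<in>T. q n * n)"
    using s(3) insert.hyps by (simp add: s1_def algebra_simps)
  have "\<exists>s r q. s \<notin> M \<and> (\<forall>n\<in>T. q n \<in> M) \<and> s * m = r * t + (\<Sum>n\<in>T. q n * n)" if mT: "m \<in> T" for m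
  proof -
    obtain s' r' q' where s': "s' \<notin> M" "\<forall>n\<in>insert m0 T. q' n \<in> M"
      "s' * m = r' * t + (\<Sum>n\<in>insert m0 T. q' n * n)" using insert.prems[of m] mT by blast
    \<comment> \<open>The relation for m is multiplied by s1 so that m0 occurs only as
      \<open>s1 * m0\<close> and can be substituted away; the new coefficients stay in M.\<close>
    have "s1 * s' * m = s1 * (s' * m)" by (simp add: mult.assoc)
    also have "\<dots> = s1 * r' * t + q' m0 * (s1 * m0) + (\<Sum>n\<in>T. s1 * q' n * n)"
      unfolding s'(3) using insert.hyps by (simp add: distrib_left sum_distrib_left mult_ac)
    also have "\<dots> = (s1 * r' + q' m0 * r) * t + (\<Sum>n\<in>T. (q' m0 * q n + s1 * q' n) * n)"
      by (simp add: m0 distrib_left distrib_right sum_distrib_left sum.distrib mult.assoc)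
    finally have "s1 * s' * m = (s1 * r' + q' m0 * r) * t + (\<Sum>n\<in>T. (q' m0 * q n + s1 * q' n) * n)" .
    moreover have "s1 * s' \<notin> M" using maximal_ideal_prime[OF M] s1 s'(1) by blast
    moreover have "\<forall>n\<in>T. q' m0 * q n + s1 * q' n \<in> M" using s(2) s'(2) Mi(2,3) by blast
    ultimately show ?thesis
      by (intro exI[of _ "s1 * s'"] exI[of _ "s1 * r' + q' m0 * r"] exI[of _ "\<lambda>n. q' m0 * q n + s1 * q' n"]) blast
  qed
  then obtain s2 where s2: "s2 \<notin> M" "\<And>m. m \<in> T \<Longrightarrow> t dvd s2 * m" using insert.IH by blast
  have "s2 * s1 * m0 = s2 * r * t + (\<Sum>n\<in>T. q n * (s2 * n))"
    using arg_cong[OF m0, of "(*) s2"] by (simp add: distrib_left sum_distrib_left mult_ac)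
  moreover have "t dvd (\<Sum>n\<in>T. q n * (s2 * n))" by (intro dvd_sum) (rule dvd_mult, rule s2(2))
  ultimately have "t dvd s2 * s1 * m0" by simp
  moreover have "t dvd s2 * s1 * m" if "m \<in> T" for m
    using dvd_mult[OF s2(2)[OF that], of s1] by (simp add: mult_ac)
  moreover have "s2 * s1 \<notin> M" using maximal_ideal_prime[OF M] s1 s2(1) by blast
  ultimately show ?case by blast
qed

section \<open>Generators of the module of vector fields\<close>

context one_place_curve
begin

text \<open>A form of the Nullstellensatz. A non-zero m in M is not constant, so it has a pole at
  infinity. Hence a is algebraic over k modulo m, and therefore modulo M.\<close>

lemma maximal_ideal_residue:
  assumes M: "maximal_ideal M" "M \<noteq> {0}"
  shows "\<exists>c. a - \<iota> c \<in> M"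
proof -
  have Mi: "0 \<in> M" "1 \<notin> M" "\<And>x r. x \<in> M \<Longrightarrow> r * x \<in> M"
    using M(1) by (auto simp: maximal_ideal_def is_ideal_def)
  obtain m where m: "m \<in> M" "m \<noteq> 0" using M(2) Mi(1) by blast
  have "emb m \<notin> V"
  proof
    assume "emb m \<in> V"
    then have "emb m \<in> range const" using K.A_Int_V by blast
    then obtain c where c: "m = \<iota> c" by (auto simp: const_def)
    then have "\<iota> (inverse c) * m = 1" using \<iota>_inverse[of c] m(2) by (simp add: mult.commute)
    then show False using Mi m(1) by metis
  qed
  then obtain p b where p: "p \<in> polys_over (range const)" "lead_coeff p = 1" "poly p (emb a) = emb m * emb b"
    using K.algebraic_modulo[of "emb a" "emb m"] by auto
  have "\<exists>c\<in>range const. emb a - c \<in> emb ` M"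
  proof (rule algebraic_residue_in_alg_closed[OF K.subring_F K.alg_closed_F K.subring_A K.F_A _ _ _ p(1)])
    show "p \<noteq> 0" using p(2) by auto
    have "b * m \<in> M" using Mi m by blast
    then show "poly p (emb a) \<in> emb ` M"
      unfolding p(3) by (intro image_eqI[of _ _ "b * m"]) (simp_all add: mult.commute)
    show "x \<in> emb ` M \<or> y \<in> emb ` M" if xy: "x \<in> range emb" "y \<in> range emb" "x * y \<in> emb ` M" for x y
    proof -
      obtain a b where ab: "x = emb a" "y = emb b" using xy by blast
      then have "a * b \<in> M" using xy(3) by (simp add: image_iff flip: emb_simps(4))
      then show ?thesis using maximal_ideal_prime[OF M(1)] ab by blast
    qed
    show "x = 0" if x: "x \<in> range const" "x \<in> emb ` M" for x
    proof (rule ccontr)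
      assume "x \<noteq> 0"
      obtain c where c: "\<iota> c \<in> M" "x = const c" using x by (auto simp: const_def)
      have "c \<noteq> 0" using c(2) \<open>x \<noteq> 0\<close> by auto
      then have "\<iota> (inverse c) * \<iota> c = 1" using \<iota>_inverse[of c] by (simp add: mult.commute)
      then show False using Mi c(1) by metis
    qed
  qed auto
  then show ?thesis by (auto simp: const_def simp flip: emb_simps(6))
qed

text \<open>Constants modulo K form a subalgebra, so every element is constant modulo K once the
  generators are. For an element of M that constant lies in M and must vanish.\<close>

lemma maximal_ideal_generated:
  assumes M: "maximal_ideal M" and S: "subalg_gen \<iota> S = UNIV"
    and K: "is_ideal K" "K \<subseteq> M" "\<And>s. s \<in> S \<Longrightarrow> \<exists>c. s - \<iota> c \<in> K"
  shows "M = K"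
proof
  have Mi: "0 \<in> M" "1 \<notin> M" "\<And>x r. x \<in> M \<Longrightarrow> r * x \<in> M" "\<And>x y. x \<in> M \<Longrightarrow> y \<in> M \<Longrightarrow> x + y \<in> M"
    using M by (auto simp: maximal_ideal_def is_ideal_def)
  have Ki: "0 \<in> K" "\<And>x r. x \<in> K \<Longrightarrow> r * x \<in> K" "\<And>x y. x \<in> K \<Longrightarrow> y \<in> K \<Longrightarrow> x + y \<in> K"
    using K(1) by (auto simp: is_ideal_def)
  have "\<exists>c. a - \<iota> c \<in> K" if "a \<in> subalg_gen \<iota> S" for a
    using that
  proof induction
    case (scal c)
    then show ?case using Ki(1) by (intro exI[of _ c]) simp
  next
    case (gen s)
    then show ?case by (rule K(3))
  next
    case (add x y)
    then obtain c d where "x - \<iota> c \<in> K" "y - \<iota> d \<in> K" by blast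
    then have "(x - \<iota> c) + (y - \<iota> d) \<in> K" by (rule Ki(3))
    moreover have "x + y - \<iota> (c + d) = (x - \<iota> c) + (y - \<iota> d)" by simp
    ultimately show ?case by metis
  next
    case (mult x y)
    then obtain c d where "x - \<iota> c \<in> K" "y - \<iota> d \<in> K" by blast
    then have "x * (y - \<iota> d) + \<iota> d * (x - \<iota> c) \<in> K" using Ki(2,3) by blast
    moreover have "x * y - \<iota> (c * d) = x * (y - \<iota> d) + \<iota> d * (x - \<iota> c)" by (simp add: algebra_simps)
    ultimately show ?case by metis
  qed
  then have const: "\<exists>c. a - \<iota> c \<in> K" for a using S by blast
  show "M \<subseteq> K"
  proof
    fix x assume "x \<in> M"
    obtain c where c: "x - \<iota> c \<in> K" using const by blast
    then have "- 1 * (x - \<iota> c) \<in> M" using K(2) Mi(3) by blast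
    from Mi(4)[OF \<open>x \<in> M\<close> this] have "\<iota> c \<in> M" by simp
    have "c = 0"
    proof (rule ccontr)
      assume "c \<noteq> 0"
      then have "\<iota> (inverse c) * \<iota> c = 1" using \<iota>_inverse by (simp add: mult.commute)
      then show False using Mi \<open>\<iota> c \<in> M\<close> by metis
    qed
    then show "x \<in> K" using c by simp
  qed
qed (rule K(2))

text \<open>The algebra generators, shifted by their residues, generate M as an ideal, so elements
  of its square are combinations of them with coefficients in M. That is the input for Nakayama's
  lemma; s is the common denominator in the localisation.\<close>

lemma maximal_ideal_locally_principal:
  fixes M :: "'a set"
  assumes M: "maximal_ideal M" "M \<noteq> {0}" and t: "\<And>x. x \<in> M \<Longrightarrow> \<exists>r. x - r * t \<in> ideal_sq M"
  shows "\<exists>s. s \<notin> M \<and> (\<forall>x\<in>M. t dvd s * x)"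
proof -
  have Mi: "0 \<in> M" "\<And>x r. x \<in> M \<Longrightarrow> r * x \<in> M" "\<And>x y. x \<in> M \<Longrightarrow> y \<in> M \<Longrightarrow> x + y \<in> M"
    using M by (auto simp: maximal_ideal_def is_ideal_def)
  obtain S where S: "finite S" "subalg_gen \<iota> S = UNIV" using fin_gen by (auto simp: fin_gen_algebra_def)
  obtain c where c: "\<And>a. a - \<iota> (c a) \<in> M" using maximal_ideal_residue[OF M] by metis
  define T where "T = (\<lambda>s. s - \<iota> (c s)) ` S"
  have T: "finite T" "T \<subseteq> M" using S c by (auto simp: T_def)
  define comb where "comb Q = {\<Sum>n\<in>T. q n * n |q. \<forall>n\<in>T. q n \<in> Q}" for Q
  have comb_add: "x + y \<in> comb Q" if xy: "x \<in> comb Q" "y \<in> comb Q" "\<And>x y. x \<in> Q \<Longrightarrow> y \<in> Q \<Longrightarrow> x + y \<in> Q" for x y Q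
  proof -
    obtain q q' where "x = (\<Sum>n\<in>T. q n * n)" "\<forall>n\<in>T. q n \<in> Q" "y = (\<Sum>n\<in>T. q' n * n)" "\<forall>n\<in>T. q' n \<in> Q"
      using xy(1,2) by (auto simp: comb_def)
    then show ?thesis
      using xy(3) by (auto simp: comb_def distrib_right sum.distrib intro!: exI[of _ "\<lambda>n. q n + q' n"])
  qed
  have comb_mult: "r * x \<in> comb Q" if xy: "x \<in> comb UNIV" "\<And>y. r * y \<in> Q" for r x Q
  proof -
    obtain q where "x = (\<Sum>n\<in>T. q n * n)" using xy(1) by (auto simp: comb_def)
    then show ?thesis
      using xy(2) by (auto simp: comb_def sum_distrib_left mult.assoc intro!: exI[of _ "\<lambda>n. r * q n"])
  qed
  have comb_0: "0 \<in> comb Q" if "0 \<in> Q" for Q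
    using that by (auto simp: comb_def intro!: exI[of _ "\<lambda>_. 0"])
  have comb_T: "n \<in> comb UNIV" if "n \<in> T" for n
    using that T(1) by (auto simp: comb_def if_distrib[of "\<lambda>x. x * _"] sum.delta
        intro!: exI[of _ "\<lambda>k. if k = n then 1 else 0"] cong: if_cong)
  have "M = comb UNIV"
  proof (rule maximal_ideal_generated[OF M(1) S(2)])
    show "is_ideal (comb UNIV)" using comb_0 comb_add comb_mult by (auto simp: is_ideal_def)
    show "comb UNIV \<subseteq> M" using T(2) by (auto simp: comb_def intro!: sum_closed Mi)
    show "\<exists>d. s - \<iota> d \<in> comb UNIV" if "s \<in> S" for s using comb_T that by (auto simp: T_def)
  qed
  moreover have "x \<in> comb M" if "x \<in> ideal_sq M" for x
    using that
  proof induction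
    case zero
    show ?case using comb_0 Mi(1) by blast
  next
    case (prod x y)
    then show ?case using comb_mult[of y x M] Mi(2)[OF prod(1)] \<open>M = comb UNIV\<close> by (simp add: mult.commute)
  next
    case (add a b)
    then show ?case using comb_add Mi(3) by blast
  qed
  ultimately have sq: "ideal_sq M \<subseteq> comb M" by blast
  have "\<exists>s. s \<notin> M \<and> (\<forall>m\<in>T. t dvd s * m)"
  proof (rule nakayama_elimination[OF M(1) T(1)])
    fix m assume "m \<in> T"
    then obtain r where "m - r * t \<in> comb M" using t sq T(2) by blast
    then obtain q where "\<forall>n\<in>T. q n \<in> M" "m - r * t = (\<Sum>n\<in>T. q n * n)" by (auto simp: comb_def)
    moreover from this have "1 * m = r * t + (\<Sum>n\<in>T. q n * n)" by (simp add: algebra_simps)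
    moreover have "1 \<notin> M" using M(1) by (simp add: maximal_ideal_def)
    ultimately show "\<exists>s r q. s \<notin> M \<and> (\<forall>n\<in>T. q n \<in> M) \<and> s * m = r * t + (\<Sum>n\<in>T. q n * n)" by blast
  qed
  then obtain s where s: "s \<notin> M" "\<And>m. m \<in> T \<Longrightarrow> t dvd s * m" by blast
  have "t dvd s * x" if "x \<in> M" for x
  proof -
    obtain q where "x = (\<Sum>n\<in>T. q n * n)" using \<open>x \<in> M\<close> \<open>M = comb UNIV\<close> by (auto simp: comb_def)
    then have "s * x = (\<Sum>n\<in>T. q n * (s * n))" by (simp add: sum_distrib_left mult_ac)
    moreover have "t dvd (\<Sum>n\<in>T. q n * (s * n))" by (intro dvd_sum) (rule dvd_mult, rule s(2))
    ultimately show ?thesis by simp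
  qed
  then show ?thesis using s(1) by blast
qed

text \<open>If the generator vanished at a point with local parameter t, dividing it by t would give
  a vector field that is not a multiple of it.\<close>
lemma generator_nowhere_vanishing:
  assumes dim: "krull_dim_one TYPE('a)" and smooth: "smooth_curve_ring TYPE('a)"
    and D: "D \<in> Vec \<iota>" "D x0 \<noteq> 0" and gen: "\<And>E. E \<in> Vec \<iota> \<Longrightarrow> \<exists>f. E = (\<lambda>x. f * D x)"
  shows "nowhere_vanishing D"
  unfolding nowhere_vanishing_def
proof (intro allI impI notI)
  fix M :: "'a set"
  assume M: "maximal_ideal M" and van: "range D \<subseteq> M"
  have Mi: "0 \<in> M" "\<And>x r. x \<in> M \<Longrightarrow> r * x \<in> M"
    using M by (auto simp: maximal_ideal_def is_ideal_def)
  have M0: "M \<noteq> {0}"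
  proof
    assume "M = {0}"
    obtain x :: 'a where x: "x \<noteq> 0" "\<not> x dvd 1" using dim by (auto simp: krull_dim_one_def)
    then obtain r where "1 = 0 + r * x" using maximal_ideal_bezout[OF M, of x] \<open>M = {0}\<close> by blast
    then show False using x(2) by (metis add_0 dvd_triv_right)
  qed
  obtain t where t: "t \<in> M" "\<And>x. x \<in> M \<Longrightarrow> \<exists>r. x - r * t \<in> ideal_sq M"
    using smooth M unfolding smooth_curve_ring_def by blast
  obtain s where s: "s \<notin> M" "\<And>x. x \<in> M \<Longrightarrow> t dvd s * x"
    using maximal_ideal_locally_principal[OF M M0 t(2)] by blast
  have t0: "t \<noteq> 0"
  proof
    assume "t = 0"
    obtain x where "x \<in> M" "x \<noteq> 0" using M0 Mi(1) by blast
    with s(2)[of x] \<open>t = 0\<close> have "s = 0" by simp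
    then show False using s(1) Mi(1) by simp
  qed
  \<comment> \<open>E will be (s/t) D: the factor s, which does not vanish at the point, makes the
    division by t possible on all of C.\<close>
  have "\<forall>x. \<exists>y. s * D x = t * y" using s(2) van by (auto elim!: dvdE simp: dvd_def image_subset_iff)
  then obtain E where E: "\<And>x. s * D x = t * E x" by metis
  note Dd = k_derivationD[OF D(1)]
  have "E \<in> Vec \<iota>"
    unfolding Vec_def k_derivation_def mem_Collect_eq
  proof (intro conjI allI)
    fix x y c
    have "t * E (x + y) = t * (E x + E y)" by (simp add: E[symmetric] Dd(1) distrib_left)
    then show "E (x + y) = E x + E y" using t0 by simp
    have "t * E (x * y) = x * (t * E y) + y * (t * E x)"
      by (simp add: E[symmetric] Dd(2) algebra_simps)
    then have "t * E (x * y) = t * (x * E y + y * E x)" by (simp add: algebra_simps)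
    then show "E (x * y) = x * E y + y * E x" using t0 by (simp only: mult_cancel_left) simp
    have "t * E (\<iota> c * x) = \<iota> c * (t * E x)" by (simp add: E[symmetric] Dd(2,3) algebra_simps)
    then have "t * E (\<iota> c * x) = t * (\<iota> c * E x)" by (simp add: algebra_simps)
    then show "E (\<iota> c * x) = \<iota> c * E x" using t0 by (simp only: mult_cancel_left) simp
  qed
  then obtain f where "E = (\<lambda>x. f * D x)" using gen by blast
  then have "s * D x0 = (f * t) * D x0" using E[of x0] by (simp add: mult_ac)
  \<comment> \<open>Comparing E with its representation f D forces s into M, against the choice of
    s.\<close>
  then have "s = f * t" using D(2) by simp
  then show False using s(1) Mi(2)[OF t(1)] by simp
qed

text \<open>The second-order terms cancel. In terms of coefficients the bracket is thus the
  Wronskian, which turns the theorem into a statement about functions.\<close>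

lemma bracket_of_multiples:
  assumes "D \<in> Vec \<iota>"
  shows "lie_bracket (\<lambda>x. f * D x) (\<lambda>x. g * D x) = (\<lambda>x. (f * D g - g * D f) * D x)"
  by (rule ext) (simp add: lie_bracket_def k_derivationD[OF assms] algebra_simps)

text \<open>The coefficient u of a nowhere vanishing field is a unit, since otherwise a maximal
  ideal containing u would contain all values of the field. So u is a non-zero constant, and a
  bracket would make it a Wronskian.\<close>

lemma no_single_bracket:
  assumes irr: "\<not> rational_curve \<iota>" and D0: "D0 \<in> Vec \<iota>" "D0 x0 \<noteq> 0"
    and gen: "\<And>E. E \<in> Vec \<iota> \<Longrightarrow> \<exists>f. E = (\<lambda>x. f * D0 x)"
    and D: "D \<in> Vec \<iota>" "nowhere_vanishing D" "D1 \<in> Vec \<iota>" "D2 \<in> Vec \<iota>" "D = lie_bracket D1 D2"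
  shows False
proof -
  obtain u f g where u: "D = (\<lambda>x. u * D0 x)" and fg: "D1 = (\<lambda>x. f * D0 x)" "D2 = (\<lambda>x. g * D0 x)"
    using gen D by metis
  have "u dvd 1"
  proof (rule ccontr)
    assume nu: "\<not> u dvd 1"
    define I where "I = {r. u dvd r}"
    have "is_ideal I" "1 \<notin> I" using nu by (auto simp: I_def is_ideal_def)
    then obtain M where "maximal_ideal M" "I \<subseteq> M" using maximal_ideal_exists by blast
    moreover have "range D \<subseteq> I" by (auto simp: u I_def)
    ultimately show False using D(2) unfolding nowhere_vanishing_def by (meson order_trans)
  qed
  then obtain c where c: "c \<noteq> 0" "u = \<iota> c" using unit_const by blast
  have "(f * D0 g - g * D0 f) * D0 x0 = u * D0 x0"
    using D(5) bracket_of_multiples[OF D0(1), of f g] unfolding fg u by metis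
  then have "f * D0 g - g * D0 f = \<iota> c" using D0(2) c(2) by simp
  then show False using rational_if_constant_wronskian[OF D0] c(1) irr by blast
qed

text \<open>The coefficients of the derived algebra form the ideal generated by the image of D, because
  2 f D h is the Wronskian of f and h plus that of 1 and f h.\<close>
lemma generator_in_derived:
  assumes D: "D \<in> Vec \<iota>" "D x0 \<noteq> 0" "nowhere_vanishing D"
    and gen: "\<And>E. E \<in> Vec \<iota> \<Longrightarrow> \<exists>f. E = (\<lambda>x. f * D x)"
  shows "D \<in> derived (Vec \<iota>)"
proof -
  define I where "I = {w. (\<lambda>x. w * D x) \<in> derived (Vec \<iota>)}"
  note Dd = k_derivationD[OF D(1)]
  have bracket: "f * D g - g * D f \<in> I" for f g
    unfolding I_def mem_Collect_eq bracket_of_multiples[OF D(1), symmetric]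
    by (intro derived.br Vec_mult D(1))
  have add: "v + w \<in> I" if "v \<in> I" "w \<in> I" for v w
    using derived.add[of "\<lambda>x. v * D x" "Vec \<iota>" "\<lambda>x. w * D x"] that by (simp add: I_def distrib_right)
  have product: "f * D h \<in> I" for f h
  proof -
    \<comment> \<open>Placing the constant one half inside both Wronskians is necessary because I is
      so far known only to be closed under sums.\<close>
    define k where "k = \<iota> (inverse 2)"
    have "inverse 2 + inverse 2 = (1::'k)" by simp
    then have k: "k + k = 1" unfolding k_def by (metis \<iota>_simps(2,3))
    have "D k = 0" by (simp add: k_def Dd)
    have "((k * f) * D h - h * D (k * f)) + (k * D (f * h) - (f * h) * D k) = (k + k) * (f * D h)"
      by (simp add: Dd(2) \<open>D k = 0\<close> algebra_simps)
    then have "((k * f) * D h - h * D (k * f)) + (k * D (f * h) - (f * h) * D k) = f * D h"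
      by (simp add: k)
    then show ?thesis using add[OF bracket[of "k * f" h] bracket[of k "f * h"]] by simp
  qed
  \<comment> \<open>\<open>derived\<close> is generated by brackets and sums alone, so all multiples
    by r are carried along in the induction; this is what makes I an ideal.\<close>
  have coeff: "\<exists>w. E = (\<lambda>x. w * D x) \<and> (\<forall>r. r * w \<in> I)" if "E \<in> derived (Vec \<iota>)" for E
    using that
  proof induction
    case (br E1 E2)
    then obtain f g where fg: "E1 = (\<lambda>x. f * D x)" "E2 = (\<lambda>x. g * D x)" using gen by metis
    have "r * (f * D g - g * D f) \<in> I" for r
      using add[OF product[of "r * f" g] product[of "- r * g" f]] by (simp add: algebra_simps)
    then show ?case using bracket_of_multiples[OF D(1), of f g] unfolding fg by blast
  next
    case (add a b)
    then obtain v w where "a = (\<lambda>x. v * D x)" "\<And>r. r * v \<in> I" "b = (\<lambda>x. w * D x)" "\<And>r. r * w \<in> I" by blast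
    moreover from this have "r * (v + w) \<in> I" for r using \<open>\<And>v w. v \<in> I \<Longrightarrow> w \<in> I \<Longrightarrow> v + w \<in> I\<close> by (simp add: distrib_left)
    ultimately show ?case by (intro exI[of _ "v + w"]) (auto simp: distrib_right)
  qed
  have "is_ideal I"
    unfolding is_ideal_def
  proof (intro conjI ballI allI)
    show "0 \<in> I" using product[of 0 0] by simp
    show "v + w \<in> I" if "v \<in> I" "w \<in> I" for v w using that by (rule add)
    show "r * w \<in> I" if w: "w \<in> I" for r w
    proof -
      obtain w' where w': "(\<lambda>x. w * D x) = (\<lambda>x. w' * D x)" "r * w' \<in> I"
        using coeff[of "\<lambda>x. w * D x"] w by (auto simp: I_def)
      from fun_cong[OF w'(1), of x0] have "w = w'" using D(2) by simp
      then show ?thesis using w'(2) by simp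
    qed
  qed
  have "1 \<in> I"
  proof (rule ccontr)
    assume "1 \<notin> I"
    then obtain M where M: "maximal_ideal M" "I \<subseteq> M" using maximal_ideal_exists \<open>is_ideal I\<close> by blast
    have "range D \<subseteq> I" using product[of 1] by auto
    then show False using M D(3) unfolding nowhere_vanishing_def by (meson order_trans)
  qed
  then show ?thesis by (simp add: I_def)
qed

end

theorem theorem3p3:
  fixes \<iota> :: "'k::field_char_0 \<Rightarrow> 'a::idom"
  assumes "alg_closed TYPE('k)"
    and "k_algebra_map \<iota>"
    and "fin_gen_algebra \<iota>"
    and "krull_dim_one TYPE('a)"
    and "smooth_curve_ring TYPE('a)"
    and "unique_place_at_infinity \<iota>"
    and "\<not> rational_curve \<iota>"
    and "tangent_sheaf_trivial \<iota>"
  shows "bracket_width_ge_two (Vec \<iota>) \<and>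
    (\<forall>D \<in> Vec \<iota>. nowhere_vanishing D \<longrightarrow> \<not> (\<exists>D1 \<in> Vec \<iota>. \<exists>D2 \<in> Vec \<iota>. D = lie_bracket D1 D2))"
proof -
  interpret one_place_curve \<iota> using assms by unfold_locales
  obtain D0 where D0: "D0 \<in> Vec \<iota>" and gen: "\<And>E. E \<in> Vec \<iota> \<Longrightarrow> \<exists>!f. E = (\<lambda>x. f * D0 x)"
    using assms(8) by (auto simp: tangent_sheaf_trivial_def)
  \<comment> \<open>For the zero field the coefficients 0 and 1 would both represent
    \<open>D0\<close>, against uniqueness in the freeness condition.\<close>
  have "\<exists>x0. D0 x0 \<noteq> 0"
  proof (rule ccontr)
    assume "\<nexists>x0. D0 x0 \<noteq> 0"
    then have "D0 = (\<lambda>x. 0 * D0 x)" "D0 = (\<lambda>x. 1 * D0 x)" by auto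
    then show False using gen[OF D0] zero_neq_one by blast
  qed
  then obtain x0 where x0: "D0 x0 \<noteq> 0" by blast
  have gen': "\<exists>f. E = (\<lambda>x. f * D0 x)" if "E \<in> Vec \<iota>" for E using gen[OF that] by blast
  have none: "\<not> (\<exists>D1 \<in> Vec \<iota>. \<exists>D2 \<in> Vec \<iota>. D = lie_bracket D1 D2)"
    if "D \<in> Vec \<iota>" "nowhere_vanishing D" for D
    using no_single_bracket[OF assms(7) D0 x0 gen' that] by blast
  have nv: "nowhere_vanishing D0"
    using generator_nowhere_vanishing[OF assms(4,5) D0 x0 gen'] by blast
  have "D0 \<in> derived (Vec \<iota>)" using generator_in_derived[OF D0 x0 nv gen'] by blast
  then show ?thesis using none nv D0 unfolding bracket_width_ge_two_def by blast
qed

end
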